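(* Let $k$ and $\lambda$ be fixed positive integers such that $k\geq 2\lambda+1$. There exists an integer $v_0$ (depending only on $k$ and $\lambda$) such that, for any cyclic $(v,k,\lambda)$-design with $v\geq v_0$, it is always possible to choose one block from each block orbit so that the chosen blocks are pairwise disjoint.
   Context: A $(v,k,\lambda)$-design is a pair $(V,\mathcal{B})$ where $V$ is a set of $v$ points and $\mathcal{B}$ is a collection (repeated blocks allowed, so a multiset) of $k$-subsets of $V$ called blocks, such that every pair of distinct elements of $V$ is contained in precisely $\lambda$ blocks of $\mathcal{B}$, counted with multiplicity. An automorphism is a permutation of $V$ leaving $\mathcal{B}$ invariant. The design is cyclic if it admits an automorphism consisting of a single cycle of length $v$; we then identify $V$ with $\mathbb{Z}_v$ so that $\mathcal{B}$ is invariant under all translations $B\mapsto B+t$, $t\in\mathbb{Z}_v$. The blocks of a cyclic design are partitioned into orbits under $\mathbb{Z}_v$, where each orbit is the set $\{B+t : t\in\mathbb{Z}_v\}$ of distinct translates of some block $B$; if the blocks in such a set have multiplicity $\mu$ in $\mathcal{B}$, then this orbit is counted $\mu$ times (as $\mu$ separate orbits). Orbits may be full (cardinality $v$) or short (cardinality less than $v$); both kinds are included. *)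

theory Defs
  imports "HOL-Library.Multiset" "HOL-Library.Disjoint_Sets" "HOL-Combinatorics.Combinatorics"
begin

definition design :: "nat \<Rightarrow> nat \<Rightarrow> nat \<Rightarrow> 'a set \<Rightarrow> 'a set multiset \<Rightarrow> bool" where
  "design v k l V \<B> \<longleftrightarrow>
     finite V \<and> card V = v \<and>
     (\<forall>b \<in># \<B>. b \<subseteq> V \<and> card b = k) \<and>
     (\<forall>x \<in> V. \<forall>y \<in> V. x \<noteq> y \<longrightarrow> size {#b \<in># \<B>. x \<in> b \<and> y \<in> b#} = l)"

definition design_automorphism :: "'a set \<Rightarrow> 'a set multiset \<Rightarrow> ('a \<Rightarrow> 'a) \<Rightarrow> bool" where
  "design_automorphism V \<B> \<sigma> \<longleftrightarrow> \<sigma> permutes V \<and> image_mset (image \<sigma>) \<B> = \<B>"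

(* Together with \<sigma> permutes V, cyclic_on \<sigma> V says that \<sigma> is a single cycle of length card V.
   Labelling V by Z_v along this cycle turns \<sigma> into the translation by 1. *)
definition cyclic_design ::
    "nat \<Rightarrow> nat \<Rightarrow> nat \<Rightarrow> 'a set \<Rightarrow> 'a set multiset \<Rightarrow> ('a \<Rightarrow> 'a) \<Rightarrow> bool" where
  "cyclic_design v k l V \<B> \<sigma> \<longleftrightarrow>
     design v k l V \<B> \<and> design_automorphism V \<B> \<sigma> \<and> cyclic_on \<sigma> V"

(* The set of translates of b. *)
abbreviation block_orbit :: "('a \<Rightarrow> 'a) \<Rightarrow> 'a set \<Rightarrow> 'a set set" where
  "block_orbit \<sigma> b \<equiv> orbit (image \<sigma>) b"

(* An orbit whose blocks have multiplicity m occurs as the m separate orbits (Orb, 0), ...,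
   (Orb, m - 1); by count_block_orbit below, m does not depend on the block chosen from Orb. *)
definition block_orbits :: "('a \<Rightarrow> 'a) \<Rightarrow> 'a set multiset \<Rightarrow> ('a set set \<times> nat) set" where
  "block_orbits \<sigma> \<B> = {(block_orbit \<sigma> b, i) | b i. b \<in># \<B> \<and> i < count \<B> b}"

lemma count_block_orbit:
  assumes "design_automorphism V \<B> \<sigma>" and "b' \<in> block_orbit \<sigma> b"
  shows "count \<B> b' = count \<B> b"
proof -
  have "inj \<sigma>" and \<B>: "image_mset (image \<sigma>) \<B> = \<B>"
    using assms(1) by (auto simp: design_automorphism_def dest: permutes_inj)
  then have inj: "inj (image \<sigma>)"
    by (simp add: inj_image_eq_iff inj_def)
  have step: "count \<B> (\<sigma> ` c) = count \<B> c" for c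
  proof -
    have "count (image_mset (image \<sigma>) M) (\<sigma> ` c) = count M c" for M
      by (induction M) (simp_all add: inj_eq[OF inj])
    from this[of \<B>] show ?thesis
      by (simp add: \<B>)
  qed
  from assms(2) show ?thesis
    by induction (simp_all add: step)
qed

lemma block_orbit_Z_v:
  fixes v :: nat
  assumes "v > 0" and "b \<subseteq> {..<v}"
  defines "\<sigma> \<equiv> \<lambda>x. if x < v then (x + 1) mod v else x"
  shows "block_orbit \<sigma> b = {(\<lambda>x. (x + t) mod v) ` b | t. t < v}"
proof -
  have translate: "(image \<sigma> ^^ t) b = (\<lambda>x. (x + t) mod v) ` b" for t
  proof (induction t)
    case 0
    have "(\<lambda>x. (x + 0) mod v) ` b = (\<lambda>x. x) ` b"
      using assms(2) by (intro image_cong) auto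
    then show ?case by simp
  next
    case (Suc t)
    have "\<sigma> ((x + t) mod v) = (x + Suc t) mod v" for x
      using assms(1) by (simp add: \<sigma>_def mod_Suc_eq)
    with Suc show ?case
      by (simp add: image_image)
  qed
  have "(\<lambda>x. (x + v) mod v) ` b = (\<lambda>x. x) ` b"
    using assms(2) by (intro image_cong) auto
  then have "(image \<sigma> ^^ v) b = b"
    by (simp add: translate)
  then show ?thesis
    using orbit_altdef_bounded[of v "image \<sigma>" b] assms(1) by (simp add: translate)
qed

end

theory Submission
  imports Defs Complex_Main
begin

text \<open>
  Represent the orbits by blocks \<open>B\<^sub>i\<close> and consider the hypergraph whose vertices are the points and
  the orbits, and whose edges are the sets \<open>{i} \<union> (B\<^sub>i + t)\<close>. An orbit has degree \<open>v\<close>, a point has degree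
  at most \<open>3 v / 4\<close> because \<open>2 l < k\<close> and there are boundedly many short orbits, and codegrees are bounded.

  Draw edges independently and uniformly and keep each one that is disjoint from those kept before.
  The probability \<open>p s S\<close> that the edges kept after \<open>s\<close> steps avoid a set \<open>S\<close> satisfies a linear recursion
  in which \<open>p (Suc s) S\<close> depends on \<open>p s (S \<union> e)\<close> for the edges \<open>e\<close> meeting \<open>S\<close>. For bounded codegrees,
  a product over the vertices in \<open>S\<close> satisfies this recursion up to a small error, and so approximates \<open>p\<close>.
  Hence all but a small proportion of the orbits get a block while the points stay uncovered with
  probability at least 1/4, and by Chebyshev's inequality all but a small proportion of the orbits
  have at least \<open>c v\<close> translates (for a constant \<open>c\<close>) that consist of uncovered points. The exceptional
  orbits are then placed greedily.
\<close>

section \<open>Greedy matchings in hypergraphs of bounded codegree\<close>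

text \<open>Both bounds go through one induction: when \<open>x\<close> joins \<open>S\<close>, the
  error in the second one gains the term \<open>\<delta> x * (B - A)\<close>, and the first one
  controls \<open>B - A\<close>. All factors stay in [0,1], so earlier errors are not
  amplified.\<close>

lemma prod_diff_bounds:
  fixes q \<delta> :: "'v \<Rightarrow> real" and h :: real
  assumes "finite S" and "h \<ge> 0"
    and "\<And>x. x \<in> S \<Longrightarrow> 0 \<le> \<delta> x \<and> \<delta> x \<le> h \<and> \<delta> x \<le> q x \<and> q x \<le> 1"
  shows "\<bar>(\<Prod>x\<in>S. q x - \<delta> x) - (\<Prod>x\<in>S. q x)\<bar> \<le> card S * h"
    and "\<bar>(\<Prod>x\<in>S. q x - \<delta> x) - (\<Prod>x\<in>S. q x) + (\<Sum>x\<in>S. \<delta> x * (\<Prod>y\<in>S - {x}. q y))\<bar>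
           \<le> (card S)\<^sup>2 * h\<^sup>2"
proof -
  have "\<bar>(\<Prod>x\<in>S. q x - \<delta> x) - (\<Prod>x\<in>S. q x)\<bar> \<le> card S * h \<and>
        \<bar>(\<Prod>x\<in>S. q x - \<delta> x) - (\<Prod>x\<in>S. q x) + (\<Sum>x\<in>S. \<delta> x * (\<Prod>y\<in>S - {x}. q y))\<bar>
           \<le> (card S)\<^sup>2 * h\<^sup>2"
    using assms(1,3)
  proof (induction S rule: finite_induct)
    case empty
    then show ?case by simp
  next
    case (insert x S)
    define A where "A = (\<Prod>x\<in>S. q x - \<delta> x)"
    define B where "B = (\<Prod>x\<in>S. q x)"
    define L where "L = (\<Sum>x\<in>S. \<delta> x * (\<Prod>y\<in>S - {x}. q y))"
    have IH: "\<bar>A - B\<bar> \<le> card S * h" "\<bar>A - B + L\<bar> \<le> (card S)\<^sup>2 * h\<^sup>2"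
      using insert unfolding A_def B_def L_def by blast+
    have x: "0 \<le> \<delta> x" "\<delta> x \<le> h" "\<delta> x \<le> q x" "q x \<le> 1"
      using insert.prems by auto
    have A01: "0 \<le> A" "A \<le> 1"
      unfolding A_def using insert.prems by (auto intro!: prod_nonneg prod_le_1, smt (verit))
    have prodx: "(\<Prod>y\<in>insert x S - {w}. q y) = q x * (\<Prod>y\<in>S - {w}. q y)" if "w \<in> S" for w
    proof -
      have "insert x S - {w} = insert x (S - {w})"
        using insert.hyps that by auto
      then show ?thesis using insert.hyps by simp
    qed
    have L': "(\<Sum>w\<in>insert x S. \<delta> w * (\<Prod>y\<in>insert x S - {w}. q y)) = \<delta> x * B + q x * L"
    proof -
      have "(\<Sum>w\<in>S. \<delta> w * (\<Prod>y\<in>insert x S - {w}. q y)) = q x * L"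
        unfolding L_def sum_distrib_left by (intro sum.cong) (simp_all add: prodx mult_ac)
      moreover have "insert x S - {x} = S" using insert.hyps by auto
      ultimately show ?thesis
        using insert.hyps by (simp add: B_def)
    qed
    have 1: "(q x - \<delta> x) * A - q x * B = q x * (A - B) - \<delta> x * A"
      by (simp add: algebra_simps)
    have 2: "(q x - \<delta> x) * A - q x * B + (\<delta> x * B + q x * L) = q x * (A - B + L) + \<delta> x * (B - A)"
      by (simp add: algebra_simps)
    have qx: "\<bar>q x * u\<bar> \<le> \<bar>u\<bar>" for u
      using x by (simp add: abs_mult mult_left_le_one_le)
    have "\<bar>\<delta> x * A\<bar> \<le> h"
      using x A01 by (simp add: abs_mult mult_le_one) (metis mult_mono' mult.right_neutral)
    then have b1: "\<bar>(q x - \<delta> x) * A - q x * B\<bar> \<le> (card S + 1) * h"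
      unfolding 1 using qx[of "A - B"] IH(1) by (simp add: algebra_simps)
    have "\<bar>\<delta> x * (B - A)\<bar> \<le> h * (card S * h)"
      unfolding abs_mult using x IH(1) by (intro mult_mono) auto
    then have b2: "\<bar>(q x - \<delta> x) * A - q x * B + (\<delta> x * B + q x * L)\<bar>
      \<le> (card S)\<^sup>2 * h\<^sup>2 + card S * h\<^sup>2"
      unfolding 2 using qx[of "A - B + L"] IH(2) by (simp add: power2_eq_square mult_ac)
    have "((card S)\<^sup>2 + card S) * h\<^sup>2 \<le> ((card S + 1)\<^sup>2) * h\<^sup>2"
      by (intro mult_right_mono) (auto simp: power2_eq_square)
    then have "(card S)\<^sup>2 * h\<^sup>2 + card S * h\<^sup>2 \<le> ((real (card S) + 1)\<^sup>2) * h\<^sup>2"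
      by (simp add: algebra_simps power2_eq_square)
    with b1 b2 show ?case
      using insert.hyps L' by (simp add: A_def[symmetric] B_def[symmetric] add_ac)
  qed
  then show "\<bar>(\<Prod>x\<in>S. q x - \<delta> x) - (\<Prod>x\<in>S. q x)\<bar> \<le> card S * h"
    and "\<bar>(\<Prod>x\<in>S. q x - \<delta> x) - (\<Prod>x\<in>S. q x) + (\<Sum>x\<in>S. \<delta> x * (\<Prod>y\<in>S - {x}. q y))\<bar>
           \<le> (card S)\<^sup>2 * h\<^sup>2" by blast+
qed

text \<open>Edges are labels \<open>e\<close> with vertex sets \<open>ed e\<close>, since different
  translates of a block in a short orbit may be the same set and are still drawn separately.\<close>

locale bounded_hypergraph =
  fixes E :: "'e set" and ed :: "'e \<Rightarrow> 'v set" and r \<Delta> C :: nat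
  assumes finite_E: "finite E" and E_nonempty: "E \<noteq> {}" and \<Delta>_pos: "\<Delta> > 0"
    and finite_ed: "e \<in> E \<Longrightarrow> finite (ed e)"
    and card_ed: "e \<in> E \<Longrightarrow> card (ed e) \<le> r"
    and degree: "card {e \<in> E. x \<in> ed e} \<le> \<Delta>"
    and codegree: "x \<noteq> y \<Longrightarrow> card {e \<in> E. x \<in> ed e \<and> y \<in> ed e} \<le> C"
begin

section \<open>The random greedy process\<close>

definition cover :: "'e set \<Rightarrow> 'v set" where
  "cover W = \<Union> (ed ` W)"

definition greedy_add :: "'e set \<Rightarrow> 'e \<Rightarrow> 'e set" where
  "greedy_add W e = (if ed e \<inter> cover W = {} then insert e W else W)"

text \<open>The transition operator of the process, acting on functions of the current state; its
  powers yield expectations without a probability space.\<close>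

definition avg :: "('e set \<Rightarrow> real) \<Rightarrow> 'e set \<Rightarrow> real" where
  "avg f W = (\<Sum>e\<in>E. f (greedy_add W e)) / card E"

definition expect :: "nat \<Rightarrow> ('e set \<Rightarrow> real) \<Rightarrow> real" where
  "expect s f = (avg ^^ s) f {}"

definition avoid :: "'v set \<Rightarrow> 'e set \<Rightarrow> real" where
  "avoid S W = of_bool (cover W \<inter> S = {})"

definition matching :: "'e set \<Rightarrow> bool" where
  "matching W \<longleftrightarrow> W \<subseteq> E \<and> disjoint_family_on ed W"

lemma card_E_pos: "card E > 0"
  using finite_E E_nonempty by (simp add: card_gt_0_iff)

text \<open>In \<open>(avg ^^ s) f {}\<close> the outermost \<open>avg\<close> is the first draw.
  Hence \<open>avg f\<close> averages over the last draw, given the outcome of the first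
  \<open>s\<close>.\<close>

lemma expect_Suc: "expect (Suc s) f = expect s (avg f)"
  by (simp add: expect_def funpow_swap1)

lemma expect_sum: "expect s (\<lambda>W. \<Sum>a\<in>A. c a * f a W) = (\<Sum>a\<in>A. c a * expect s (f a))"
proof (induction s arbitrary: f)
  case 0
  then show ?case by (simp add: expect_def)
next
  case (Suc s)
  have "avg (\<lambda>W. \<Sum>a\<in>A. c a * f a W) = (\<lambda>W. \<Sum>a\<in>A. c a * avg (f a) W)"
    unfolding avg_def sum_divide_distrib sum_distrib_left
    by (subst sum.swap) simp
  then show ?case
    by (simp add: expect_Suc Suc)
qed

lemma expect_add: "expect s (\<lambda>W. f W + g W) = expect s f + expect s g"
  using expect_sum[of s "\<lambda>_. 1" "\<lambda>b. if b then f else g" UNIV] by (simp add: UNIV_bool add_ac)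

lemma expect_mult: "expect s (\<lambda>W. c * f W) = c * expect s f"
  using expect_sum[of s "\<lambda>_. c" "\<lambda>_. f" "{()}"] by simp

lemma expect_const: "expect s (\<lambda>W. c) = c"
proof (induction s)
  case (Suc s)
  have "avg (\<lambda>W. c) = (\<lambda>W. c)"
    using card_E_pos by (auto simp: avg_def)
  with Suc show ?case by (simp add: expect_Suc)
qed (simp add: expect_def)

lemma matching_greedy_add:
  assumes "matching W" and "e \<in> E"
  shows "matching (greedy_add W e)"
  using assms unfolding matching_def greedy_add_def cover_def disjoint_family_on_def
  by auto

text \<open>Every step preserves matchings, so averages never leave them; the induction therefore
  runs over all matchings as starting states. The strict form gives the first-moment principle by
  contraposition.\<close>

lemma expect_greater:
  assumes "\<And>W. matching W \<Longrightarrow> f W > c"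
  shows "expect s f > c"
proof -
  have "\<forall>W. matching W \<longrightarrow> (avg ^^ s) f W > c"
  proof (induction s)
    case 0
    then show ?case using assms by simp
  next
    case (Suc s)
    show ?case
    proof (intro allI impI)
      fix W assume "matching W"
      then have "(\<Sum>e\<in>E. c) < (\<Sum>e\<in>E. (avg ^^ s) f (greedy_add W e))"
        using Suc matching_greedy_add finite_E E_nonempty by (intro sum_strict_mono) auto
      then show "c < (avg ^^ Suc s) f W"
        using card_E_pos by (simp add: avg_def field_simps)
    qed
  qed
  moreover have "matching {}"
    by (simp add: matching_def disjoint_family_on_def)
  ultimately show ?thesis
    by (simp add: expect_def)
qed

lemma matching_le_expect: "\<exists>W. matching W \<and> f W \<le> expect s f"
  using expect_greater[of "expect s f" f s] by fastforce

section \<open>Avoidance probabilities\<close>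

definition p :: "nat \<Rightarrow> 'v set \<Rightarrow> real" where
  "p s S = expect s (avoid S)"

text \<open>A draw of \<open>e\<close> ends the avoidance of \<open>S\<close> exactly if
  \<open>e\<close> meets \<open>S\<close> and is kept, and it is kept if the earlier edges avoid
  \<open>ed e\<close>. Together this is the event that they avoid
  \<open>S \<union> ed e\<close>.\<close>

lemma p_Suc:
  "p (Suc s) S = p s S - (\<Sum>e | e \<in> E \<and> ed e \<inter> S \<noteq> {}. p s (S \<union> ed e)) / card E"
proof -
  let ?M = "{e \<in> E. ed e \<inter> S \<noteq> {}}"
  have step: "avoid S (greedy_add W e) = avoid S W - (if ed e \<inter> S \<noteq> {} then avoid (S \<union> ed e) W else 0)"
    for W e
    by (cases "ed e \<inter> cover W = {}") (auto simp: avoid_def greedy_add_def cover_def)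
  have "(\<Sum>e\<in>E. avoid S (greedy_add W e)) = card E * avoid S W - (\<Sum>e\<in>?M. avoid (S \<union> ed e) W)" for W
    unfolding step sum_subtractf using finite_E by (simp add: sum.inter_filter)
  then have "avg (avoid S) = (\<lambda>W. avoid S W + (- 1 / card E) * (\<Sum>e\<in>?M. 1 * avoid (S \<union> ed e) W))"
    using card_E_pos by (auto simp: avg_def field_simps)
  then show ?thesis
    unfolding p_def expect_Suc expect_add expect_mult expect_sum by (simp only: expect_add expect_mult expect_sum) simp
qed

lemma expect_mono:
  assumes "\<And>W. f W \<le> g W"
  shows "expect s f \<le> expect s g"
  using assms
proof (induction s arbitrary: f g)
  case (Suc s)
  have "avg f W \<le> avg g W" for W
    unfolding avg_def using Suc.prems by (intro divide_right_mono sum_mono) auto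
  then show ?case
    by (simp add: expect_Suc Suc.IH)
qed (simp add: expect_def)

lemma p_bounds: "0 \<le> p s S" "p s S \<le> 1"
  using expect_mono[of "\<lambda>_. 0" "avoid S" s] expect_mono[of "avoid S" "\<lambda>_. 1" s]
  by (auto simp: p_def avoid_def expect_const)


text \<open>The numbers \<open>q s x\<close> solve the mean-field version of the recursion for \<open>p s {x}\<close>, in which the
  vertices of an edge are avoided independently of each other.\<close>

primrec q :: "nat \<Rightarrow> 'v \<Rightarrow> real" where
  "q 0 x = 1"
| "q (Suc s) x = q s x - (\<Sum>e | e \<in> E \<and> x \<in> ed e. \<Prod>y\<in>ed e. q s y) / card E"

text \<open>Upper bound for the probability that a draw hits a given vertex; it acts as the step
  size of the recursion.\<close>

definition h :: real where "h = \<Delta> / card E"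

text \<open>Local error per unit of step size: \<open>h\<close> stems from second-order terms,
  \<open>C / \<Delta>\<close> from edges that meet a set twice.\<close>

definition defect :: real where "defect = h + C / \<Delta>"

lemma h_pos: "h > 0"
  using card_E_pos \<Delta>_pos by (simp add: h_def)

lemma defect_pos: "defect > 0"
  using h_pos \<Delta>_pos by (simp add: defect_def add_pos_nonneg)

text \<open>Each product over an edge through \<open>x\<close> contains the factor
  \<open>q s x\<close>, and at most \<open>card E\<close> edges are summed, so the decrement is at
  most \<open>q s x\<close>.\<close>

lemma q_bounds: "0 \<le> q s x \<and> q s x \<le> 1"
proof (induction s arbitrary: x)
  case (Suc s)
  let ?M = "{e \<in> E. x \<in> ed e}"
  have "(\<Prod>y\<in>ed e. q s y) \<le> q s x" if "e \<in> ?M" for e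
  proof -
    have "(\<Prod>y\<in>ed e. q s y) = q s x * (\<Prod>y\<in>ed e - {x}. q s y)"
      using that finite_ed by (intro prod.remove) auto
    also have "\<dots> \<le> q s x * 1"
      using Suc by (intro mult_left_mono prod_le_1) auto
    finally show ?thesis by simp
  qed
  then have "(\<Sum>e\<in>?M. \<Prod>y\<in>ed e. q s y) \<le> card ?M * q s x"
    by (intro sum_bounded_above) auto
  also have "\<dots> \<le> card E * q s x"
    using finite_E Suc by (intro mult_right_mono) (auto intro!: card_mono)
  finally have "(\<Sum>e\<in>?M. \<Prod>y\<in>ed e. q s y) / card E \<le> q s x"
    using card_E_pos by (simp add: field_simps)
  moreover have "0 \<le> (\<Sum>e\<in>?M. \<Prod>y\<in>ed e. q s y) / card E"
    using Suc by (intro divide_nonneg_nonneg sum_nonneg prod_nonneg) auto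
  ultimately show ?case
    using Suc[of x] by simp
qed simp

lemma q_decrement: "0 \<le> q s x - q (Suc s) x" "q s x - q (Suc s) x \<le> h"
proof -
  let ?M = "{e \<in> E. x \<in> ed e}"
  show "0 \<le> q s x - q (Suc s) x"
    using q_bounds by (auto intro!: divide_nonneg_nonneg sum_nonneg prod_nonneg)
  have "(\<Sum>e\<in>?M. \<Prod>y\<in>ed e. q s y) \<le> real (card ?M) * 1"
    using q_bounds by (intro sum_bounded_above prod_le_1) auto
  also have "\<dots> \<le> \<Delta>" using degree by simp
  finally show "q s x - q (Suc s) x \<le> h"
    by (simp add: h_def divide_right_mono)
qed

section \<open>The product ansatz and its local error\<close>

definition \<pi> :: "nat \<Rightarrow> 'v set \<Rightarrow> real" where
  "\<pi> s S = (\<Prod>x\<in>S. q s x)"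

lemma \<pi>_bounds: "0 \<le> \<pi> s S" "\<pi> s S \<le> 1"
  unfolding \<pi>_def using q_bounds by (auto intro!: prod_nonneg prod_le_1)

lemma card_meeting:
  assumes "finite S"
  shows "card {e \<in> E. ed e \<inter> S \<noteq> {}} \<le> card S * \<Delta>"
proof -
  have "{e \<in> E. ed e \<inter> S \<noteq> {}} = (\<Union>x\<in>S. {e \<in> E. x \<in> ed e})" by auto
  also have "card \<dots> \<le> (\<Sum>x\<in>S. card {e \<in> E. x \<in> ed e})"
    using assms by (rule card_UN_le)
  also have "\<dots> \<le> card S * \<Delta>"
    using degree sum_bounded_above[of S "\<lambda>x. card {e \<in> E. x \<in> ed e}" \<Delta>] by simp
  finally show ?thesis .
qed

lemma card_meeting_twice:
  assumes "finite S"
  shows "card {e \<in> E. \<exists>x\<in>S. \<exists>y\<in>S. x \<noteq> y \<and> x \<in> ed e \<and> y \<in> ed e} \<le> (card S)\<^sup>2 * C"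
proof -
  let ?P = "{z \<in> S \<times> S. fst z \<noteq> snd z}"
  have fin: "finite ?P" using assms by simp
  have "{e \<in> E. \<exists>x\<in>S. \<exists>y\<in>S. x \<noteq> y \<and> x \<in> ed e \<and> y \<in> ed e}
      = (\<Union>z\<in>?P. {e \<in> E. fst z \<in> ed e \<and> snd z \<in> ed e})" by (auto; blast)
  also have "card \<dots> \<le> (\<Sum>z\<in>?P. card {e \<in> E. fst z \<in> ed e \<and> snd z \<in> ed e})"
    using fin by (rule card_UN_le)
  also have "\<dots> \<le> card ?P * C"
    using codegree sum_bounded_above[of ?P "\<lambda>z. card {e \<in> E. fst z \<in> ed e \<and> snd z \<in> ed e}" C] by simp
  also have "card ?P \<le> card (S \<times> S)"
    using assms by (intro card_mono) auto
  then have "card ?P * C \<le> (card S)\<^sup>2 * C"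
    by (simp add: card_cartesian_product power2_eq_square)
  finally show ?thesis .
qed

text \<open>The linear term \<open>L\<close> of the product expansion is a sum over edges meeting
  \<open>S\<close>. An edge with a single vertex in \<open>S\<close> contributes exactly
  \<open>\<pi> s (S \<union> ed e)\<close>; the edges with two or more are few because codegrees are
  bounded.\<close>

lemma \<pi>_Suc:
  assumes S: "finite S"
  shows "\<bar>\<pi> (Suc s) S - (\<pi> s S - (\<Sum>e | e \<in> E \<and> ed e \<inter> S \<noteq> {}. \<pi> s (S \<union> ed e)) / card E)\<bar>
           \<le> card S ^ 3 * (h * defect)"
proof -
  let ?M = "{e \<in> E. ed e \<inter> S \<noteq> {}}"
  let ?D = "{e \<in> E. \<exists>x\<in>S. \<exists>y\<in>S. x \<noteq> y \<and> x \<in> ed e \<and> y \<in> ed e}"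
  let ?n = "real (card S)"
  define \<delta> where "\<delta> x = q s x - q (Suc s) x" for x
  define L where "L = (\<Sum>x\<in>S. \<delta> x * (\<Prod>y\<in>S - {x}. q s y))"
  \<comment> \<open>The contribution of \<open>e\<close> to \<open>L\<close>, with one summand for
    each vertex that \<open>e\<close> shares with \<open>S\<close>.\<close>
  define g where "g e = (\<Sum>x\<in>S \<inter> ed e. \<pi> s (ed e) * \<pi> s (S - {x}))" for e
  have q_Suc: "q (Suc s) x = q s x - \<delta> x" for x by (simp add: \<delta>_def)
  have "0 \<le> \<delta> x \<and> \<delta> x \<le> h \<and> \<delta> x \<le> q s x \<and> q s x \<le> 1" for x
    using q_decrement[of s x] q_bounds[of s x] q_bounds[of "Suc s" x] unfolding \<delta>_def by linarith
  then have "\<bar>\<pi> (Suc s) S - \<pi> s S + L\<bar> \<le> ?n\<^sup>2 * h\<^sup>2"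
    unfolding \<pi>_def L_def q_Suc using S h_pos prod_diff_bounds(2)[of S h \<delta> "q s"] by simp
  moreover have "\<bar>L - (\<Sum>e\<in>?M. \<pi> s (S \<union> ed e)) / card E\<bar> \<le> ?n ^ 3 * C / card E"
  proof -
    have "L = (\<Sum>x\<in>S. (\<Sum>e\<in>{e \<in> E. x \<in> ed e}. \<pi> s (ed e)) / card E * \<pi> s (S - {x}))"
      unfolding L_def \<delta>_def \<pi>_def by simp
    also have "\<dots> = (\<Sum>x\<in>S. \<Sum>e\<in>{e \<in> ?M. x \<in> ed e}. \<pi> s (ed e) * \<pi> s (S - {x})) / card E"
      unfolding sum_divide_distrib sum_distrib_right
      by (intro sum.cong) auto
    also have "\<dots> = (\<Sum>e\<in>?M. \<Sum>x\<in>{x \<in> S. x \<in> ed e}. \<pi> s (ed e) * \<pi> s (S - {x})) / card E"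
      using S finite_E by (subst sum.swap_restrict) auto
    also have "\<dots> = (\<Sum>e\<in>?M. g e) / card E"
      unfolding g_def by (intro arg_cong2[of _ _ _ _ "(/)"] sum.cong) auto
    finally have L: "L = (\<Sum>e\<in>?M. g e) / card E" .
    have eq: "g e = \<pi> s (S \<union> ed e)" if "e \<in> ?M - ?D" for e
    proof -
      from that obtain x where x: "S \<inter> ed e = {x}" by blast
      then have "S \<union> ed e = ed e \<union> (S - {x})" "ed e \<inter> (S - {x}) = {}" by auto
      then have "\<pi> s (S \<union> ed e) = \<pi> s (ed e) * \<pi> s (S - {x})"
        using that S finite_ed by (simp add: \<pi>_def prod.union_disjoint)
      then show ?thesis by (simp add: g_def x)
    qed
    have le: "\<bar>g e - \<pi> s (S \<union> ed e)\<bar> \<le> ?n" if "e \<in> ?M" for e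
    proof -
      have "g e \<le> real (card (S \<inter> ed e)) * 1"
        unfolding g_def using \<pi>_bounds by (intro sum_bounded_above mult_le_one) auto
      also have "\<dots> \<le> ?n" using S by (auto intro!: card_mono)
      finally have "g e \<le> ?n" .
      moreover have "g e \<ge> 0"
        unfolding g_def using \<pi>_bounds by (intro sum_nonneg mult_nonneg_nonneg) auto
      moreover have "card S > 0"
        using that S by (auto simp: card_gt_0_iff)
      ultimately show ?thesis
        using \<pi>_bounds[of s "S \<union> ed e"] by (simp add: abs_le_iff)
    qed
    have "\<bar>(\<Sum>e\<in>?M. g e) - (\<Sum>e\<in>?M. \<pi> s (S \<union> ed e))\<bar> \<le> (\<Sum>e\<in>?M. \<bar>g e - \<pi> s (S \<union> ed e)\<bar>)"
      unfolding sum_subtractf[symmetric] by (rule sum_abs)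
    also have "\<dots> = (\<Sum>e\<in>?M \<inter> ?D. \<bar>g e - \<pi> s (S \<union> ed e)\<bar>)"
    proof (rule sum.mono_neutral_right)
      show "\<forall>e\<in>?M - ?M \<inter> ?D. \<bar>g e - \<pi> s (S \<union> ed e)\<bar> = 0"
      proof
        fix e assume "e \<in> ?M - ?M \<inter> ?D"
        then have "e \<in> ?M - ?D" by blast
        from eq[OF this] show "\<bar>g e - \<pi> s (S \<union> ed e)\<bar> = 0" by simp
      qed
    qed (use finite_E in auto)
    also have "\<dots> \<le> card (?M \<inter> ?D) * ?n"
      using le by (intro sum_bounded_above) auto
    also have "\<dots> \<le> (?n\<^sup>2 * C) * ?n"
    proof -
      have "card (?M \<inter> ?D) \<le> card ?D"
        using finite_E by (intro card_mono) auto
      also have "\<dots> \<le> (card S)\<^sup>2 * C" by (rule card_meeting_twice[OF S])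
      finally have "real (card (?M \<inter> ?D)) \<le> real ((card S)\<^sup>2 * C)" by (rule of_nat_mono)
      then show ?thesis by (intro mult_right_mono) auto
    qed
    also have "\<dots> = ?n ^ 3 * C" by (simp add: power2_eq_square power3_eq_cube)
    finally show ?thesis
      unfolding L diff_divide_distrib[symmetric] abs_divide by (simp add: divide_right_mono)
  qed
  ultimately have "\<bar>\<pi> (Suc s) S - (\<pi> s S - (\<Sum>e\<in>?M. \<pi> s (S \<union> ed e)) / card E)\<bar>
      \<le> ?n\<^sup>2 * h\<^sup>2 + ?n ^ 3 * C / card E" by linarith
  also have "\<dots> \<le> ?n ^ 3 * h\<^sup>2 + ?n ^ 3 * C / card E"
  proof -
    have "?n\<^sup>2 \<le> ?n ^ 3"
      by (cases "card S = 0") (auto intro!: power_increasing)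
    then show ?thesis by (auto intro!: mult_right_mono)
  qed
  also have "\<dots> = ?n ^ 3 * (h * defect)"
  proof -
    have "h * defect = h\<^sup>2 + C / card E"
      using \<Delta>_pos by (simp add: defect_def h_def distrib_left power2_eq_square)
    then show ?thesis by (simp add: distrib_left)
  qed
  finally show ?thesis by simp
qed

section \<open>Propagation of the error\<close>

lemma error_Suc:
  assumes S: "finite S"
  shows "\<bar>p (Suc s) S - \<pi> (Suc s) S\<bar>
     \<le> \<bar>p s S - \<pi> s S\<bar> + (\<Sum>e | e \<in> E \<and> ed e \<inter> S \<noteq> {}. \<bar>p s (S \<union> ed e) - \<pi> s (S \<union> ed e)\<bar>) / card E
        + card S ^ 3 * (h * defect)"
proof -
  let ?M = "{e \<in> E. ed e \<inter> S \<noteq> {}}"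
  have "\<bar>(\<Sum>e\<in>?M. p s (S \<union> ed e)) - (\<Sum>e\<in>?M. \<pi> s (S \<union> ed e))\<bar>
      \<le> (\<Sum>e\<in>?M. \<bar>p s (S \<union> ed e) - \<pi> s (S \<union> ed e)\<bar>)"
    unfolding sum_subtractf[symmetric] by (rule sum_abs)
  then have "\<bar>(\<Sum>e\<in>?M. p s (S \<union> ed e)) / card E - (\<Sum>e\<in>?M. \<pi> s (S \<union> ed e)) / card E\<bar>
      \<le> (\<Sum>e\<in>?M. \<bar>p s (S \<union> ed e) - \<pi> s (S \<union> ed e)\<bar>) / card E"
    unfolding diff_divide_distrib[symmetric] abs_divide by (simp add: divide_right_mono)
  with \<pi>_Suc[OF S, of s] p_Suc[of s S] show ?thesis by linarith
qed

text \<open>The recursion bounds the error on \<open>S\<close> by errors on larger sets. A weight \<open>b ^ card S\<close> with a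
  slowly growing base \<open>b\<close> absorbs the factor \<open>card S\<close> which this costs (Bernoulli's inequality).\<close>

lemma error_step:
  assumes err: "\<And>S. finite S \<Longrightarrow> \<bar>p s S - \<pi> s S\<bar> \<le> w * b ^ card S"
    and b: "2 \<le> b" and w: "w \<ge> 0" and S: "finite S"
  shows "\<bar>p (Suc s) S - \<pi> (Suc s) S\<bar> \<le> (w + 4 * h * defect) * (b * (1 + h * b ^ r)) ^ card S"
proof -
  let ?M = "{e \<in> E. ed e \<inter> S \<noteq> {}}"
  let ?j = "card S"
  have "(\<Sum>e\<in>?M. \<bar>p s (S \<union> ed e) - \<pi> s (S \<union> ed e)\<bar>) \<le> card ?M * (w * b ^ (?j + r))"
  proof (intro sum_bounded_above)
    fix e assume e: "e \<in> ?M"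
    have "card (S \<union> ed e) \<le> ?j + r"
      using card_Un_le[of S "ed e"] card_ed[of e] e by simp
    then have "b ^ card (S \<union> ed e) \<le> b ^ (?j + r)"
      using b by (intro power_increasing) auto
    then show "\<bar>p s (S \<union> ed e) - \<pi> s (S \<union> ed e)\<bar> \<le> w * b ^ (?j + r)"
      using err[of "S \<union> ed e"] e S finite_ed w by (auto intro: order_trans mult_left_mono)
  qed
  also have "\<dots> \<le> real (?j * \<Delta>) * (w * b ^ (?j + r))"
    using card_meeting[OF S] w b by (intro mult_right_mono of_nat_mono) auto
  finally have "(\<Sum>e\<in>?M. \<bar>p s (S \<union> ed e) - \<pi> s (S \<union> ed e)\<bar>) / card E
      \<le> real (?j * \<Delta>) * (w * b ^ (?j + r)) / card E"
    by (rule divide_right_mono) simp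
  also have "\<dots> = w * b ^ ?j * (?j * (h * b ^ r))"
    by (simp add: h_def power_add field_simps)
  finally have "\<bar>p (Suc s) S - \<pi> (Suc s) S\<bar>
      \<le> w * b ^ ?j * (1 + ?j * (h * b ^ r)) + ?j ^ 3 * (h * defect)"
    using error_Suc[OF S, of s] err[OF S] by (simp add: algebra_simps)
  also have "1 + ?j * (h * b ^ r) \<le> (1 + h * b ^ r) ^ ?j"
    using Bernoulli_inequality[of "h * b ^ r" ?j] h_pos b by (simp add: order.trans[OF _ mult_nonneg_nonneg])
  then have "w * b ^ ?j * (1 + ?j * (h * b ^ r)) \<le> w * (b * (1 + h * b ^ r)) ^ ?j"
    unfolding power_mult_distrib mult.assoc[symmetric] using w b by (intro mult_left_mono) auto
  moreover have "?j ^ 3 * (h * defect) \<le> 4 * (b * (1 + h * b ^ r)) ^ ?j * (h * defect)"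
  proof -
    \<comment> \<open>Absorbs the cubic factor of the local error into the exponential weight;
      equality at \<open>n = 4\<close> dictates the constant 4.\<close>
    have "n ^ 3 \<le> 4 * 2 ^ n" for n :: nat
    proof (induction n rule: nat_less_induct)
      case (1 n)
      show ?case
      proof (cases "n \<le> 4")
        case True
        then have "n \<in> {0,1,2,3,4}" by auto
        then show ?thesis by auto
      next
        case False
        then obtain m where m: "n = Suc m" "m \<ge> 4" by (cases n) auto
        have "3 * m\<^sup>2 + 3 * m + 1 \<le> m ^ 3"
        proof -
          have "4 * m\<^sup>2 \<le> m ^ 3" using m by (simp add: power2_eq_square power3_eq_cube)
          moreover have "4 * m \<le> m\<^sup>2" using m by (simp add: power2_eq_square)
          ultimately show ?thesis using m by linarith
        qed
        moreover have "n ^ 3 = m ^ 3 + (3 * m\<^sup>2 + 3 * m + 1)"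
          by (simp add: m power3_eq_cube power2_eq_square algebra_simps)
        moreover have "m ^ 3 \<le> 4 * 2 ^ m" using 1 m by auto
        ultimately show ?thesis by (simp add: m)
      qed
    qed
    from of_nat_mono[OF this[of ?j], where 'a = real] have "real ?j ^ 3 \<le> 4 * 2 ^ ?j" by simp
    also have "\<dots> \<le> 4 * (b * (1 + h * b ^ r)) ^ ?j"
    proof -
      have "2 * 1 \<le> b * (1 + h * b ^ r)"
        using b h_pos by (intro mult_mono) auto
      then show ?thesis by (auto intro: power_mono)
    qed
    finally show ?thesis
      using h_pos defect_pos by (intro mult_right_mono) auto
  qed
  ultimately show ?thesis
    by (simp add: algebra_simps)
qed

text \<open>While the base is at most 4, a step raises it by at most \<open>h * 4 ^ Suc r\<close>.
  So its growth is linear in the number of steps, and the hypothesis on \<open>n\<close> keeps it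
  between 2 and 4.\<close>

lemma error_chunk:
  assumes err: "\<And>S. finite S \<Longrightarrow> \<bar>p s S - \<pi> s S\<bar> \<le> w * 2 ^ card S"
    and w: "w \<ge> 0" and n: "n * h * 4 ^ Suc r \<le> 2" and S: "finite S"
  shows "\<bar>p (s + n) S - \<pi> (s + n) S\<bar> \<le> (w + 4 * real n * h * defect) * 4 ^ card S"
proof -
  have main: "\<forall>S. finite S \<longrightarrow> \<bar>p (s + n) S - \<pi> (s + n) S\<bar>
      \<le> (w + 4 * real n * h * defect) * (2 + n * h * 4 ^ Suc r) ^ card S"
    using n
  proof (induction n)
    case 0
    then show ?case using err by simp
  next
    case (Suc n)
    define b where "b = 2 + n * h * 4 ^ Suc r"
    have pos: "0 \<le> h * 4 ^ Suc r" using h_pos by simp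
    have le: "n * h * 4 ^ Suc r + h * 4 ^ Suc r \<le> 2"
      using Suc.prems by (simp add: algebra_simps)
    have "0 \<le> n * h * 4 ^ Suc r" using h_pos by simp
    then have b: "2 \<le> b" "b \<le> 4"
      using le pos unfolding b_def by linarith+
    have "b * (1 + h * b ^ r) \<le> b + 4 * (h * 4 ^ r)"
    proof -
      have "b * (h * b ^ r) \<le> 4 * (h * 4 ^ r)"
        using b h_pos by (intro mult_mono power_mono) auto
      then show ?thesis by (simp add: algebra_simps)
    qed
    then have b': "b * (1 + h * b ^ r) \<le> 2 + Suc n * h * 4 ^ Suc r"
      by (simp add: b_def algebra_simps)
    have w': "0 \<le> w + 4 * real n * h * defect"
      using w h_pos defect_pos by simp
    have IH: "\<bar>p (s + n) S - \<pi> (s + n) S\<bar> \<le> (w + 4 * real n * h * defect) * b ^ card S"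
      if "finite S" for S
      using Suc.IH le pos that by (auto simp: b_def)
    show ?case
    proof (intro allI impI)
      fix S :: "'v set" assume "finite S"
      from error_step[OF IH b(1) w' this]
      have "\<bar>p (s + Suc n) S - \<pi> (s + Suc n) S\<bar>
          \<le> (w + 4 * real n * h * defect + 4 * h * defect) * (b * (1 + h * b ^ r)) ^ card S"
        by simp
      also have "\<dots> \<le> (w + 4 * real n * h * defect + 4 * h * defect) * (2 + Suc n * h * 4 ^ Suc r) ^ card S"
        using b' b h_pos w' defect_pos by (intro mult_left_mono power_mono) auto
      finally show "\<bar>p (s + Suc n) S - \<pi> (s + Suc n) S\<bar>
          \<le> (w + 4 * real (Suc n) * h * defect) * (2 + Suc n * h * 4 ^ Suc r) ^ card S"
        by (simp add: algebra_simps)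
    qed
  qed
  have "(w + 4 * real n * h * defect) * (2 + n * h * 4 ^ Suc r) ^ card S
      \<le> (w + 4 * real n * h * defect) * 4 ^ card S"
    using n w h_pos defect_pos by (intro mult_left_mono power_mono) auto
  with main S show ?thesis by (meson order_trans)
qed

end

text \<open>After the base has grown from 2 to 4 it is reset to 2: as the error is at most 1, a bound
  \<open>w * 4 ^ j\<close> implies the bound \<open>sqrt w * 2 ^ j\<close>. The number of such rounds does not depend on the
  hypergraph.\<close>

primrec error_bound :: "real \<Rightarrow> nat \<Rightarrow> real" where
  "error_bound x 0 = 0"
| "error_bound x (Suc n) = sqrt (error_bound x n + 4 * x)"

lemma error_bound_nonneg: "x \<ge> 0 \<Longrightarrow> error_bound x n \<ge> 0"
  by (induction n) auto

text \<open>Continuity at 0 of a fixed number of nested roots: half of the square of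
  \<open>\<omega>\<close> is granted to the previous round and half to \<open>4 * x\<close>.\<close>

lemma error_bound_small:
  assumes "\<omega> > 0"
  shows "\<exists>\<delta>>0. \<forall>x. 0 \<le> x \<and> x \<le> \<delta> \<longrightarrow> error_bound x n \<le> \<omega>"
  using assms
proof (induction n arbitrary: \<omega>)
  case 0
  then show ?case by (auto intro: exI[of _ 1])
next
  case (Suc n)
  then obtain \<delta> where \<delta>: "\<delta> > 0" "\<And>x. 0 \<le> x \<and> x \<le> \<delta> \<Longrightarrow> error_bound x n \<le> \<omega>\<^sup>2 / 2"
    by (metis half_gt_zero zero_less_power)
  show ?case
  proof (intro exI[of _ "min \<delta> (\<omega>\<^sup>2 / 8)"] conjI allI impI)
    show "0 < min \<delta> (\<omega>\<^sup>2 / 8)" using \<delta> Suc.prems by simp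
    fix x assume "0 \<le> x \<and> x \<le> min \<delta> (\<omega>\<^sup>2 / 8)"
    then have "error_bound x n + 4 * x \<le> \<omega>\<^sup>2" using \<delta>(2)[of x] by simp
    then show "error_bound x (Suc n) \<le> \<omega>"
      using Suc.prems by (simp add: real_le_lsqrt)
  qed
qed

context bounded_hypergraph
begin

text \<open>Induction on rounds of at most \<open>L\<close> steps, the last of which has
  \<open>m\<close> steps. Each round is an application of \<open>error_chunk\<close> followed by the
  reset of the base.\<close>

lemma error_le_error_bound:
  fixes L n s :: nat
  assumes L: "L * h * 4 ^ Suc r \<le> 2" and "s \<le> n * L" and "finite S"
  shows "\<bar>p s S - \<pi> s S\<bar> \<le> error_bound defect n * 2 ^ card S"
  using assms(2,3)
proof (induction n arbitrary: s S)
  case 0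
  then have "p s S = 1" "\<pi> s S = 1"
    by (auto simp: p_def expect_def avoid_def cover_def \<pi>_def)
  then show ?case by simp
next
  case (Suc n)
  define m where "m = min s L"
  define w where "w = error_bound defect n"
  have w: "w \<ge> 0" using defect_pos by (simp add: w_def error_bound_nonneg)
  have "s - m \<le> n * L" using Suc.prems by (auto simp: m_def)
  then have "\<bar>p (s - m) S - \<pi> (s - m) S\<bar> \<le> w * 2 ^ card S" if "finite S" for S
    using Suc.IH that by (simp add: w_def)
  moreover have mL: "m * h * 4 ^ Suc r \<le> L * h * 4 ^ Suc r"
    using h_pos by (intro mult_right_mono) (auto simp: m_def)
  ultimately have bound: "\<bar>p (s - m + m) S - \<pi> (s - m + m) S\<bar> \<le> (w + 4 * real m * h * defect) * 4 ^ card S"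
    using L Suc.prems w by (intro error_chunk) auto
  have s: "s - m + m = s" by (simp add: m_def)
  have "(w + 4 * real m * h * defect) * 4 ^ card S \<le> (w + 4 * defect) * 4 ^ card S"
  proof -
    \<comment> \<open>A round spans at most one unit of the time \<open>m * h\<close>, so the local
      errors in it add up to at most \<open>4 * defect\<close>.\<close>
    have "(4 :: real) \<le> 4 ^ Suc r" by (simp add: self_le_power)
    then have "m * h * 4 \<le> m * h * 4 ^ Suc r" using h_pos by (intro mult_left_mono) auto
    then have "m * h \<le> 1" using mL L by linarith
    then have "(m * h) * (4 * defect) \<le> 1 * (4 * defect)"
      using defect_pos by (intro mult_right_mono) auto
    then show ?thesis by (intro mult_right_mono) (auto simp: algebra_simps)
  qed
  with bound[unfolded s] have "\<bar>p s S - \<pi> s S\<bar> \<le> (w + 4 * defect) * 4 ^ card S"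
    by (rule order_trans)
  also have "\<dots> = (sqrt (w + 4 * defect) * 2 ^ card S)\<^sup>2"
  proof -
    have "(4 :: real) ^ card S = (2 ^ card S)\<^sup>2"
      by (simp add: power2_eq_square flip: power_mult_distrib)
    then show ?thesis using w defect_pos by (simp add: power_mult_distrib)
  qed
  finally have 1: "\<bar>p s S - \<pi> s S\<bar> \<le> (sqrt (w + 4 * defect) * 2 ^ card S)\<^sup>2" .
  have 2: "\<bar>p s S - \<pi> s S\<bar> \<le> 1"
    using p_bounds[of s S] \<pi>_bounds[of s S] by linarith
  \<comment> \<open>The reset: a number that is at most 1 and at most the square of \<open>u\<close>
    is at most \<open>u\<close>, and the root of \<open>4 ^ card S\<close> is
    \<open>2 ^ card S\<close>.\<close>
  have "\<bar>p s S - \<pi> s S\<bar> \<le> u" if "\<bar>p s S - \<pi> s S\<bar> \<le> u\<^sup>2" "u \<ge> 0" for u :: real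
  proof (cases "u \<le> 1")
    case True
    with that have "u\<^sup>2 \<le> u" by (simp add: power2_eq_square mult_left_le)
    with that show ?thesis by linarith
  qed (use 2 in linarith)
  from this[OF 1] show ?case
    using w defect_pos by (simp add: w_def)
qed

end

section \<open>Families of uniform orbits\<close>

text \<open>A short orbit is also listed with \<open>v\<close> translates, with repetitions, so that
  all orbits look alike; \<open>pairs\<close> counts the repetitions. By \<open>few_orbits\<close>,
  one block from each orbit covers at most 3/4 of the points.\<close>

locale uniform_orbits =
  fixes V :: "'a set" and I :: "'i set" and block :: "'i \<Rightarrow> nat \<Rightarrow> 'a set" and v k C :: nat
  assumes finite_V: "finite V" and card_V: "card V = v"
    and finite_I: "finite I" and k_pos: "k > 0" and k_le_C: "k \<le> C"
    and block: "i \<in> I \<Longrightarrow> t < v \<Longrightarrow> block i t \<subseteq> V \<and> card (block i t) = k"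
    and regular: "i \<in> I \<Longrightarrow> x \<in> V \<Longrightarrow> card {t. t < v \<and> x \<in> block i t} = k"
    and pairs: "x \<in> V \<Longrightarrow> y \<in> V \<Longrightarrow> x \<noteq> y \<Longrightarrow>
      card {(i, t). i \<in> I \<and> t < v \<and> x \<in> block i t \<and> y \<in> block i t} \<le> C"
    and few_orbits: "4 * k * card I \<le> 3 * v"
begin

lemma finite_block: "i \<in> I \<Longrightarrow> t < v \<Longrightarrow> finite (block i t)"
  using finite_subset[OF _ finite_V] block by simp

lemma block_in_V: "i \<in> I \<Longrightarrow> t < v \<Longrightarrow> x \<in> block i t \<Longrightarrow> x \<in> V"
  using block by blast

lemma card_translates_meeting:
  assumes "i \<in> I" and "U \<subseteq> V"
  shows "card {t. t < v \<and> block i t \<inter> U \<noteq> {}} \<le> k * card U"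
proof -
  have U: "finite U" using finite_subset[OF assms(2) finite_V] .
  have "{t. t < v \<and> block i t \<inter> U \<noteq> {}} = (\<Union>x\<in>U. {t. t < v \<and> x \<in> block i t})" by auto
  also have "card \<dots> \<le> (\<Sum>x\<in>U. card {t. t < v \<and> x \<in> block i t})"
    using U by (rule card_UN_le)
  also have "\<dots> = (\<Sum>x\<in>U. k)"
    using assms regular by (intro sum.cong) auto
  finally show ?thesis by (simp add: mult.commute)
qed

text \<open>At any time at most \<open>card A + k * card G\<close> points are forbidden, and each of
  them rules out only \<open>k\<close> translates of an orbit, so some member of \<open>T i\<close>
  remains.\<close>

lemma greedy_selection:
  assumes G: "G \<subseteq> I" and A: "A \<subseteq> V"
    and T: "\<And>i. i \<in> G \<Longrightarrow> T i \<subseteq> {..<v}"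
    and large: "\<And>i. i \<in> G \<Longrightarrow> k * (card A + k * card G) < card (T i)"
  shows "\<exists>\<tau>. (\<forall>i\<in>G. \<tau> i \<in> T i \<and> block i (\<tau> i) \<inter> A = {}) \<and>
              disjoint_family_on (\<lambda>i. block i (\<tau> i)) G"
proof -
  have fin: "finite G" using finite_subset[OF G finite_I] .
  have "\<exists>\<tau>. (\<forall>i\<in>G'. \<tau> i \<in> T i \<and> block i (\<tau> i) \<inter> A = {}) \<and>
              disjoint_family_on (\<lambda>i. block i (\<tau> i)) G'" if "finite G'" "G' \<subseteq> G" for G'
    using that
  proof (induction G' rule: finite_induct)
    case empty
    then show ?case by (simp add: disjoint_family_on_def)
  next
    case (insert i G')
    then obtain \<tau> where \<tau>: "\<And>j. j \<in> G' \<Longrightarrow> \<tau> j \<in> T j \<and> block j (\<tau> j) \<inter> A = {}"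
      and disj: "disjoint_family_on (\<lambda>j. block j (\<tau> j)) G'" by auto
    define U where "U = A \<union> (\<Union>j\<in>G'. block j (\<tau> j))"
    have j: "j \<in> I \<and> \<tau> j < v" if "j \<in> G'" for j
      using \<tau>[OF that] T[of j] that insert.prems G by auto
    then have "block j (\<tau> j) \<subseteq> V" if "j \<in> G'" for j
      using block that by blast
    then have "U \<subseteq> V" using A by (auto simp: U_def)
    have i: "i \<in> G" "i \<in> I" using insert.prems G by auto
    have "card (\<Union>j\<in>G'. block j (\<tau> j)) \<le> (\<Sum>j\<in>G'. card (block j (\<tau> j)))"
      using insert.hyps by (intro card_UN_le)
    also have "\<dots> = k * card G'" using j block by (simp add: mult.commute)
    also have "\<dots> \<le> k * card G"
      using insert.prems fin by (intro mult_left_mono card_mono) auto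
    finally have "card U \<le> card A + k * card G"
      unfolding U_def using card_Un_le[of A "\<Union>j\<in>G'. block j (\<tau> j)"] by linarith
    then have "k * card U \<le> k * (card A + k * card G)" by simp
    with card_translates_meeting[OF i(2) \<open>U \<subseteq> V\<close>] large[OF i(1)]
    have "card {t. t < v \<and> block i t \<inter> U \<noteq> {}} < card (T i)" by linarith
    moreover have "card (T i) \<le> card {t. t < v \<and> block i t \<inter> U \<noteq> {}}"
      if "\<forall>t\<in>T i. block i t \<inter> U \<noteq> {}"
      using that T[OF i(1)] by (intro card_mono) auto
    ultimately have "\<not> (\<forall>t\<in>T i. block i t \<inter> U \<noteq> {})" by linarith
    then obtain t where t: "t \<in> T i" "block i t \<inter> U = {}" by blast
    let ?\<tau> = "\<tau>(i := t)"
    have "\<forall>j\<in>insert i G'. ?\<tau> j \<in> T j \<and> block j (?\<tau> j) \<inter> A = {}"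
      using t \<tau> by (auto simp: U_def)
    moreover have "block i t \<inter> block j (\<tau> j) = {}" if "j \<in> G'" for j
      using t that by (auto simp: U_def)
    then have "disjoint_family_on (\<lambda>j. block j (?\<tau> j)) (insert i G')"
      using disj insert.hyps by (auto simp: disjoint_family_on_def Int_commute)
    ultimately show ?case by blast
  qed
  with fin show ?thesis by blast
qed

lemma card_point_edges:
  assumes "x \<in> V"
  shows "card {z \<in> I \<times> {..<v}. x \<in> block (fst z) (snd z)} = k * card I"
proof -
  have "{z \<in> I \<times> {..<v}. x \<in> block (fst z) (snd z)} = (SIGMA i:I. {t. t < v \<and> x \<in> block i t})"
    by auto
  then show ?thesis
    using finite_I regular assms by (simp add: card_SigmaI mult.commute)
qed

end

section \<open>The hypergraph of points and orbits\<close>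

locale nonempty_uniform_orbits = uniform_orbits V I block v k C
  for V :: "'a set" and I :: "'i set" and block v k C +
  assumes I_nonempty: "I \<noteq> {}"
begin

lemma card_I_pos: "card I > 0"
  using finite_I I_nonempty by (simp add: card_gt_0_iff)

lemma k_card_I_le: "k * card I \<le> v" and v_pos: "v > 0"
proof -
  show "k * card I \<le> v" using few_orbits by simp
  moreover have "0 < k * card I" using k_pos card_I_pos by simp
  ultimately show "v > 0" by linarith
qed

lemma card_I_le: "card I \<le> v"
  using mult_le_mono1[of 1 k "card I"] k_card_I_le k_pos by linarith

text \<open>The vertex \<open>Inr i\<close> lies in all edges of the orbit \<open>i\<close>, so the
  edges of a matching come from distinct orbits.\<close>

definition edge :: "'i \<times> nat \<Rightarrow> ('a + 'i) set" where
  "edge z = insert (Inr (fst z)) (Inl ` block (fst z) (snd z))"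

sublocale bounded_hypergraph "I \<times> {..<v}" edge "Suc k" v C
proof
  show "finite (I \<times> {..<v})" "I \<times> {..<v} \<noteq> {}" "v > 0"
    using finite_I I_nonempty v_pos by auto
next
  fix z assume z: "z \<in> I \<times> {..<v}"
  then show "finite (edge z)"
    using finite_block by (auto simp: edge_def)
  show "card (edge z) \<le> Suc k"
    unfolding edge_def using z finite_block block
    by (auto simp: card_image card_insert_if)
next
  fix x :: "'a + 'i"
  show "card {z \<in> I \<times> {..<v}. x \<in> edge z} \<le> v"
  proof (cases x)
    case (Inl a)
    show ?thesis
    proof (cases "a \<in> V")
      case True
      have "{z \<in> I \<times> {..<v}. x \<in> edge z} = {z \<in> I \<times> {..<v}. a \<in> block (fst z) (snd z)}"
        by (auto simp: edge_def Inl)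
      then show ?thesis using card_point_edges[OF True] k_card_I_le by simp
    next
      case False
      then have "{z \<in> I \<times> {..<v}. x \<in> edge z} = {}"
        using block_in_V by (auto simp: edge_def Inl)
      then show ?thesis by (simp only: card.empty le0)
    qed
  next
    case (Inr i)
    have "card {z \<in> I \<times> {..<v}. x \<in> edge z} \<le> card ({i} \<times> {..<v})"
      by (intro card_mono) (auto simp: edge_def Inr)
    then show ?thesis by simp
  qed
next
  \<comment> \<open>A point lies in \<open>k\<close> of the translates listed for an orbit, whence
    the assumption \<open>k \<le> C\<close>.\<close>
  have mixed: "card {z \<in> I \<times> {..<v}. Inl a \<in> edge z \<and> Inr i \<in> edge z} \<le> C" for a i
  proof (cases "a \<in> V \<and> i \<in> I")
    case True
    have "{z \<in> I \<times> {..<v}. Inl a \<in> edge z \<and> Inr i \<in> edge z} = {i} \<times> {t. t < v \<and> a \<in> block i t}"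
      using True by (auto simp: edge_def)
    then show ?thesis using True regular k_le_C by (simp add: card_cartesian_product)
  next
    case False
    then have "{z \<in> I \<times> {..<v}. Inl a \<in> edge z \<and> Inr i \<in> edge z} = {}"
      using block_in_V by (auto simp: edge_def)
    then show ?thesis by (simp only: card.empty le0)
  qed
  fix x y :: "'a + 'i" assume "x \<noteq> y"
  show "card {z \<in> I \<times> {..<v}. x \<in> edge z \<and> y \<in> edge z} \<le> C"
  proof (cases x; cases y)
    fix a b assume xy: "x = Inl a" "y = Inl b"
    show ?thesis
    proof (cases "a \<in> V \<and> b \<in> V")
      case True
      have "{z \<in> I \<times> {..<v}. x \<in> edge z \<and> y \<in> edge z}
          = {(i, t). i \<in> I \<and> t < v \<and> a \<in> block i t \<and> b \<in> block i t}"
        by (auto simp: edge_def xy)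
      then show ?thesis using pairs[of a b] True xy \<open>x \<noteq> y\<close> by simp
    next
      case False
      then have "{z \<in> I \<times> {..<v}. x \<in> edge z \<and> y \<in> edge z} = {}"
        using block_in_V by (auto simp: edge_def xy)
      then show ?thesis by (simp only: card.empty le0)
    qed
  next
    fix i j assume xy: "x = Inr i" "y = Inr j"
    then have "{z \<in> I \<times> {..<v}. x \<in> edge z \<and> y \<in> edge z} = {}"
      using \<open>x \<noteq> y\<close> by (auto simp: edge_def)
    then show ?thesis by (simp only: card.empty le0)
  next
    fix a i assume "x = Inl a" "y = Inr i"
    then show ?thesis using mixed by simp
  next
    fix a i assume "x = Inr i" "y = Inl a"
    then show ?thesis using mixed by (simp add: conj_commute)
  qed
qed

section \<open>Mean-field values on orbits and points\<close>

definition \<theta> :: real where "\<theta> = k * card I / v"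

text \<open>The value of \<open>q\<close> on orbits. The base of the \<open>k\<close>-th power is
  the value on points, called \<open>uncovered\<close> below; it is spelled out here to make the
  recursion closed.\<close>

primrec unmatched :: "nat \<Rightarrow> real" where
  "unmatched 0 = 1"
| "unmatched (Suc s) = unmatched s - unmatched s * (1 - \<theta> * (1 - unmatched s)) ^ k / card I"

text \<open>One block from each orbit covers the proportion \<open>\<theta>\<close> of the points,
  and the proportion \<open>1 - unmatched s\<close> of the orbits has received a block.\<close>

definition uncovered :: "nat \<Rightarrow> real" where
  "uncovered s = 1 - \<theta> * (1 - unmatched s)"

text \<open>Each edge has one orbit and \<open>k\<close> points, so all edges have the same product
  \<open>P\<close> and decrements depend on degrees only. The degrees \<open>k * card I\<close> of a
  point and \<open>v\<close> of an orbit have ratio \<open>\<theta>\<close>, which preserves the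
  affine relation between the two values.\<close>

lemma q_values:
  shows "i \<in> I \<Longrightarrow> q s (Inr i) = unmatched s" and "a \<in> V \<Longrightarrow> q s (Inl a) = uncovered s"
proof -
  have "(\<forall>i\<in>I. q s (Inr i) = unmatched s) \<and> (\<forall>a\<in>V. q s (Inl a) = uncovered s)"
  proof (induction s)
    case 0
    then show ?case by (simp add: uncovered_def)
  next
    case (Suc s)
    define P where "P = unmatched s * uncovered s ^ k"
    have P: "(\<Prod>y\<in>edge z. q s y) = P" if zI: "z \<in> I \<times> {..<v}" for z
    proof -
      obtain i t where z: "z = (i, t)" "i \<in> I" "t < v" using zI by auto
      have "(\<Prod>y\<in>edge z. q s y) = q s (Inr i) * (\<Prod>a\<in>block i t. q s (Inl a))"
        using z finite_block[of i t] by (auto simp: edge_def prod.reindex image_iff)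
      also have "(\<Prod>a\<in>block i t. q s (Inl a)) = (\<Prod>a\<in>block i t. uncovered s)"
        using z block[of i t] Suc by (intro prod.cong) auto
      finally show ?thesis using z block[of i t] Suc by (simp add: P_def)
    qed
    have q_Suc: "q (Suc s) x = q s x - card {z \<in> I \<times> {..<v}. x \<in> edge z} * P / (card I * v)" for x
      using P by (simp add: card_cartesian_product)
    show ?case
    proof (intro conjI ballI)
      fix i assume "i \<in> I"
      then have "{z \<in> I \<times> {..<v}. Inr i \<in> edge z} = {i} \<times> {..<v}" by (auto simp: edge_def)
      then have "card {z \<in> I \<times> {..<v}. Inr i \<in> edge z} = v" by (simp add: card_cartesian_product)
      then show "q (Suc s) (Inr i) = unmatched (Suc s)"
        unfolding q_Suc using Suc \<open>i \<in> I\<close> v_pos by (simp add: P_def uncovered_def)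
    next
      fix a assume a: "a \<in> V"
      then have "{z \<in> I \<times> {..<v}. Inl a \<in> edge z} = {z \<in> I \<times> {..<v}. a \<in> block (fst z) (snd z)}"
        by (auto simp: edge_def)
      then have "card {z \<in> I \<times> {..<v}. Inl a \<in> edge z} = k * card I"
        using card_point_edges[OF a] by simp
      then have "q (Suc s) (Inl a) = uncovered s - \<theta> * (P / card I)"
        unfolding q_Suc using Suc a card_I_pos by (simp add: \<theta>_def)
      also have "\<dots> = uncovered (Suc s)"
        by (simp add: uncovered_def P_def algebra_simps)
      finally show "q (Suc s) (Inl a) = uncovered (Suc s)" .
    qed
  qed
  then show "i \<in> I \<Longrightarrow> q s (Inr i) = unmatched s" and "a \<in> V \<Longrightarrow> q s (Inl a) = uncovered s"
    by blast+
qed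

lemma unmatched_bounds: "0 \<le> unmatched s" "unmatched s \<le> 1"
proof -
  from I_nonempty obtain i where "i \<in> I" by auto
  from q_values(1)[OF this, of s] q_bounds[of s "Inr i"]
  show "0 \<le> unmatched s" "unmatched s \<le> 1" by auto
qed

text \<open>\<open>few_orbits\<close> amounts to \<open>\<theta> \<le> 3 / 4\<close>.\<close>

lemma uncovered_bounds: "1 / 4 \<le> uncovered s" "uncovered s \<le> 1"
proof -
  have "real (4 * k * card I) \<le> real (3 * v)" using few_orbits by (rule of_nat_mono)
  then have "0 \<le> \<theta>" "\<theta> \<le> 3 / 4" using v_pos by (simp_all add: \<theta>_def field_simps)
  moreover from this have "\<theta> * (1 - unmatched s) \<le> 3 / 4 * 1"
    using unmatched_bounds[of s] by (intro mult_mono) auto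
  ultimately show "1 / 4 \<le> uncovered s" "uncovered s \<le> 1"
    using unmatched_bounds[of s] by (auto simp: uncovered_def)
qed

text \<open>As at least a quarter of the points stays uncovered, each step multiplies
  \<open>unmatched\<close> by at most \<open>1 - (1 / 4) ^ k / card I\<close>.\<close>

lemma unmatched_le_exp: "unmatched s \<le> exp (- ((1 / 4) ^ k * s / card I))"
proof (induction s)
  case (Suc s)
  define c :: real where "c = (1 / 4) ^ k / card I"
  have "(1 / 4) ^ k \<le> uncovered s ^ k"
    using uncovered_bounds by (intro power_mono) auto
  then have "unmatched s * c \<le> unmatched s * (uncovered s ^ k / card I)"
    unfolding c_def using unmatched_bounds by (intro mult_left_mono divide_right_mono) auto
  then have "unmatched (Suc s) \<le> unmatched s * (1 - c)"
    by (simp add: uncovered_def algebra_simps)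
  also have "\<dots> \<le> unmatched s * exp (- c)"
    using unmatched_bounds exp_ge_add_one_self[of "- c"] by (intro mult_left_mono) auto
  also have "\<dots> \<le> exp (- ((1 / 4) ^ k * s / card I)) * exp (- c)"
    using Suc by (intro mult_right_mono) auto
  also have "\<dots> = exp (- ((1 / 4) ^ k * Suc s / card I))"
    by (simp add: c_def exp_add[symmetric] add_divide_distrib algebra_simps)
  finally show ?case .
qed simp

section \<open>Second moments of the number of uncovered translates\<close>

definition free :: "'i \<Rightarrow> ('i \<times> nat) set \<Rightarrow> nat set" where
  "free i W = {t. t < v \<and> Inl ` block i t \<inter> cover W = {}}"

lemma card_free: "real (card (free i W)) = (\<Sum>t<v. avoid (Inl ` block i t) W)"
proof -
  have "free i W = {t \<in> {..<v}. cover W \<inter> Inl ` block i t = {}}" by (auto simp: free_def)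
  then show ?thesis
    by (simp add: avoid_def sum_of_bool_eq Int_def)
qed

lemma \<pi>_points:
  assumes "S \<subseteq> V"
  shows "\<pi> s (Inl ` S) = uncovered s ^ card S"
proof -
  have "\<pi> s (Inl ` S) = (\<Prod>a\<in>S. q s (Inl a))"
    by (simp add: \<pi>_def prod.reindex)
  also have "\<dots> = (\<Prod>a\<in>S. uncovered s)"
    using assms q_values(2) by (intro prod.cong) auto
  finally show ?thesis by simp
qed

lemma avoid_mult: "avoid S W * avoid S' W = avoid (S \<union> S') W"
  by (auto simp: avoid_def)

text \<open>The expanded square involves the probabilities that two translates are both uncovered.
  For disjoint translates, \<open>err\<close> makes this nearly \<open>z * z\<close>; a translate
  meets at most \<open>k * k\<close> others or itself, and for these pairs the bound 1
  suffices.\<close>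

lemma variance_free:
  fixes w :: real
  assumes err: "\<And>S. finite S \<Longrightarrow> \<bar>p s S - \<pi> s S\<bar> \<le> w * 2 ^ card S"
    and w: "w \<ge> 0" and i: "i \<in> I"
  shows "expect s (\<lambda>W. (card (free i W) - v * uncovered s ^ k)\<^sup>2) \<le> v\<^sup>2 * (3 * 4 ^ k * w) + k\<^sup>2 * v"
proof -
  define z where "z = uncovered s ^ k"
  define B where "B t = (Inl ` block i t :: ('a + 'i) set)" for t
  \<comment> \<open>Bounds the error on sets of at most \<open>2 * k\<close> vertices, hence on one
    translate and on the union of two.\<close>
  define \<epsilon> where "\<epsilon> = w * 4 ^ k"
  have z: "0 \<le> z" "z \<le> 1"
    using uncovered_bounds[of s] by (auto simp: z_def intro!: zero_le_power power_le_one)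
  have finB: "finite (B t)" if "t < v" for t
    using finite_block i that by (simp add: B_def)
  have small: "w * 2 ^ j \<le> \<epsilon>" if "j \<le> 2 * k" for j
  proof -
    have "(2 :: real) ^ j \<le> 2 ^ (2 * k)" using that by (intro power_increasing) auto
    also have "\<dots> = 4 ^ k" by (simp add: power_mult)
    finally show ?thesis unfolding \<epsilon>_def using w by (rule mult_left_mono)
  qed
  have one: "p s (B t) \<ge> z - \<epsilon>" if t: "t < v" for t
  proof -
    have "card (B t) = k" using block[OF i t] by (simp add: B_def card_image)
    then have "\<bar>p s (B t) - z\<bar> \<le> \<epsilon>"
      using err[OF finB[OF t]] small[of k] \<pi>_points[of "block i t" s] block[OF i t]
      by (simp add: B_def z_def)
    then show ?thesis by linarith
  qed
  have two: "p s (B t \<union> B t') \<le> z\<^sup>2 + \<epsilon> + of_bool (B t \<inter> B t' \<noteq> {})" if t: "t < v" "t' < v" for t t'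
  proof (cases "B t \<inter> B t' = {}")
    case True
    have "B t \<union> B t' = Inl ` (block i t \<union> block i t')" by (auto simp: B_def)
    moreover have "card (block i t \<union> block i t') = k + k"
      using True block i t finite_block by (subst card_Un_disjoint) (auto simp: B_def)
    moreover from calculation have "card (B t \<union> B t') = k + k" by (simp add: card_image)
    moreover have "finite (B t \<union> B t')" using finB t by simp
    from err[OF this] have "\<bar>p s (B t \<union> B t') - \<pi> s (B t \<union> B t')\<bar> \<le> w * 2 ^ card (B t \<union> B t')" .
    ultimately have "\<bar>p s (B t \<union> B t') - z\<^sup>2\<bar> \<le> \<epsilon>"
      using t small[of "k + k"]
        \<pi>_points[of "block i t \<union> block i t'" s] block[OF i t(1)] block[OF i t(2)]
      by (simp add: z_def power_add power2_eq_square)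
    then show ?thesis using True by simp
  next
    case False
    then show ?thesis
      using p_bounds(2)[of s "B t \<union> B t'"] w by (simp add: \<epsilon>_def add_increasing)
  qed
  \<comment> \<open>The factors \<open>1 *\<close> give the sums the shape of the linear
    combinations in \<open>expect_sum\<close>.\<close>
  have sq: "(card (free i W) - v * z)\<^sup>2 =
      (\<Sum>x\<in>{..<v} \<times> {..<v}. 1 * avoid (B (fst x) \<union> B (snd x)) W)
      + ((- 2 * v * z) * (\<Sum>t<v. 1 * avoid (B t) W) + (v * z)\<^sup>2)" for W
  proof -
    have "(\<Sum>t<v. avoid (B t) W)\<^sup>2 = (\<Sum>x\<in>{..<v} \<times> {..<v}. avoid (B (fst x) \<union> B (snd x)) W)"
      by (simp add: power2_eq_square sum_product avoid_mult sum.cartesian_product case_prod_beta)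
    then show ?thesis
      by (simp add: card_free B_def power2_diff algebra_simps)
  qed
  have "expect s (\<lambda>W. (card (free i W) - v * z)\<^sup>2) =
      (\<Sum>x\<in>{..<v} \<times> {..<v}. p s (B (fst x) \<union> B (snd x))) - 2 * v * z * (\<Sum>t<v. p s (B t)) + (v * z)\<^sup>2"
    unfolding sq expect_add expect_mult expect_sum expect_const p_def by simp
  moreover have "(\<Sum>t<v. p s (B t)) \<ge> v * (z - \<epsilon>)"
    using one sum_bounded_below[of "{..<v}" "z - \<epsilon>" "\<lambda>t. p s (B t)"] by simp
  then have "2 * v * z * (\<Sum>t<v. p s (B t)) \<ge> 2 * v * z * (v * (z - \<epsilon>))"
    using z by (intro mult_left_mono) auto
  moreover have "(\<Sum>x\<in>{..<v} \<times> {..<v}. p s (B (fst x) \<union> B (snd x))) \<le> v\<^sup>2 * (z\<^sup>2 + \<epsilon>) + k\<^sup>2 * v"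
  proof -
    have "(\<Sum>x\<in>{..<v} \<times> {..<v}. p s (B (fst x) \<union> B (snd x)))
        \<le> (\<Sum>x\<in>{..<v} \<times> {..<v}. z\<^sup>2 + \<epsilon> + of_bool (B (fst x) \<inter> B (snd x) \<noteq> {}))"
    proof (rule sum_mono)
      fix x assume "x \<in> {..<v} \<times> {..<v}"
      then show "p s (B (fst x) \<union> B (snd x)) \<le> z\<^sup>2 + \<epsilon> + of_bool (B (fst x) \<inter> B (snd x) \<noteq> {})"
        using two[of "fst x" "snd x"] by (simp add: mem_Times_iff)
    qed
    also have "\<dots> = v\<^sup>2 * (z\<^sup>2 + \<epsilon>) + (\<Sum>t<v. \<Sum>t'<v. of_bool (B t \<inter> B t' \<noteq> {}))"
      by (simp add: sum.distrib card_cartesian_product power2_eq_square sum.cartesian_product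
          case_prod_beta del: sum_of_bool_eq)
    also have "(\<Sum>t<v. \<Sum>t'<v. of_bool (B t \<inter> B t' \<noteq> {})) \<le> (\<Sum>t<v. real (k\<^sup>2))"
    proof (intro sum_mono)
      fix t assume "t \<in> {..<v}"
      have "(\<Sum>t'<v. of_bool (B t \<inter> B t' \<noteq> {})) = real (card {t'. t' < v \<and> block i t' \<inter> block i t \<noteq> {}})"
        by (auto simp: sum_of_bool_eq B_def intro!: arg_cong[where f = card])
      also have "\<dots> \<le> real (k * card (block i t))"
        using i \<open>t \<in> {..<v}\<close> block by (intro of_nat_mono card_translates_meeting) auto
      finally show "(\<Sum>t'<v. of_bool (B t \<inter> B t' \<noteq> {})) \<le> real (k\<^sup>2)"
        using block i \<open>t \<in> {..<v}\<close> by (simp add: power2_eq_square)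
    qed
    finally show ?thesis by (simp add: mult.commute)
  qed
  ultimately have "expect s (\<lambda>W. (card (free i W) - v * z)\<^sup>2)
      \<le> v\<^sup>2 * (z\<^sup>2 + \<epsilon>) + k\<^sup>2 * v - 2 * v * z * (v * (z - \<epsilon>)) + (v * z)\<^sup>2" by linarith
  also have "\<dots> = v\<^sup>2 * (\<epsilon> + 2 * (z * \<epsilon>)) + k\<^sup>2 * v"
    by (simp add: power2_eq_square algebra_simps)
  also have "\<dots> \<le> v\<^sup>2 * (3 * \<epsilon>) + k\<^sup>2 * v"
  proof -
    have "z * \<epsilon> \<le> 1 * \<epsilon>" using z w by (intro mult_right_mono) (auto simp: \<epsilon>_def)
    then show ?thesis by (intro add_right_mono mult_left_mono) auto
  qed
  finally show ?thesis by (simp add: z_def \<epsilon>_def mult_ac)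
qed


section \<open>From expectations to a matching and a selection\<close>

definition bad :: "nat \<Rightarrow> ('i \<times> nat) set \<Rightarrow> 'i set" where
  "bad s W = {i \<in> I. card (free i W) < v * uncovered s ^ k / 2}"

definition leftover :: "('i \<times> nat) set \<Rightarrow> 'i set" where
  "leftover W = {i \<in> I. Inr i \<notin> cover W}"

text \<open>A single matching must do well in two respects, so the first-moment principle is applied
  to the sum \<open>F\<close> of the number of unmatched orbits and the weighted squared deviations.
  The latter dominate the number of bad orbits, as in Chebyshev's inequality.\<close>

lemma exists_good_matching:
  fixes w :: real
  assumes err: "\<And>S. finite S \<Longrightarrow> \<bar>p s S - \<pi> s S\<bar> \<le> w * 2 ^ card S" and w: "w \<ge> 0"
  shows "\<exists>W. matching W \<and> card (leftover W) + card (bad s W)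
           \<le> card I * (unmatched s + 2 * w + 4 * 16 ^ k * (3 * 4 ^ k * w + k\<^sup>2 / v))"
proof -
  define \<mu> where "\<mu> = v * uncovered s ^ k"
  \<comment> \<open>Since \<open>\<mu>\<close> is at least \<open>v / 4 ^ k\<close>, this weight
    makes every deviation by \<open>\<mu> / 2\<close> or more count at least 1.\<close>
  define c :: real where "c = 4 * 16 ^ k / v\<^sup>2"
  define F where "F W = (\<Sum>i\<in>I. 1 * avoid {Inr i} W) + (\<Sum>i\<in>I. c * (card (free i W) - \<mu>)\<^sup>2)" for W
  have c: "c > 0" using v_pos by (simp add: c_def)
  have z: "(1 / 4) ^ k \<le> uncovered s ^ k"
    using uncovered_bounds by (intro power_mono) auto
  have \<mu>: "v * (1 / 4) ^ k \<le> \<mu>"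
    unfolding \<mu>_def using z by (intro mult_left_mono) auto
  have c\<mu>: "1 \<le> c * (\<mu> / 2)\<^sup>2"
  proof -
    have "(v * (1 / 4) ^ k)\<^sup>2 \<le> \<mu>\<^sup>2" using \<mu> by (intro power_mono) auto
    then have "c * (v * (1 / 4) ^ k)\<^sup>2 \<le> c * \<mu>\<^sup>2" using c by (intro mult_left_mono) auto
    moreover have "c * (v * (1 / 4) ^ k)\<^sup>2 = 4"
    proof -
      have "((1 / 4) ^ k)\<^sup>2 * 16 ^ k = (1 :: real)"
        by (simp add: power2_eq_square flip: power_mult_distrib)
      then have "4 * ((v :: real)\<^sup>2 * (((1 / 4) ^ k)\<^sup>2 * 16 ^ k)) / v\<^sup>2 = 4"
        using v_pos by simp
      then show ?thesis by (simp add: c_def power_mult_distrib mult_ac)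
    qed
    ultimately show ?thesis by (simp add: power_divide)
  qed
  obtain W where W: "matching W" "F W \<le> expect s F"
    using matching_le_expect by blast
  have "card (leftover W) + card (bad s W) \<le> F W"
  proof -
    have "leftover W = I \<inter> {i. cover W \<inter> {Inr i} = {}}" by (auto simp: leftover_def)
    then have "(\<Sum>i\<in>I. 1 * avoid {Inr i} W) = card (leftover W)"
      using finite_I by (simp add: avoid_def sum_of_bool_eq)
    moreover have "real (card (bad s W)) * 1 \<le> (\<Sum>i\<in>bad s W. c * (card (free i W) - \<mu>)\<^sup>2)"
    proof (intro sum_bounded_below)
      fix i assume "i \<in> bad s W"
      then have "\<mu> / 2 \<le> \<mu> - card (free i W)" by (simp add: bad_def \<mu>_def)
      moreover have "0 \<le> \<mu>" using uncovered_bounds[of s] by (simp add: \<mu>_def)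
      ultimately have "(\<mu> / 2)\<^sup>2 \<le> (\<mu> - card (free i W))\<^sup>2" by (intro power_mono) auto
      then have "c * (\<mu> / 2)\<^sup>2 \<le> c * (card (free i W) - \<mu>)\<^sup>2"
        using c by (simp add: power2_commute)
      with c\<mu> show "1 \<le> c * (card (free i W) - \<mu>)\<^sup>2" by linarith
    qed
    moreover have "(\<Sum>i\<in>bad s W. c * (card (free i W) - \<mu>)\<^sup>2) \<le> (\<Sum>i\<in>I. c * (card (free i W) - \<mu>)\<^sup>2)"
      using finite_I c by (intro sum_mono2) (auto simp: bad_def)
    ultimately show ?thesis by (simp add: F_def)
  qed
  moreover have "expect s F = (\<Sum>i\<in>I. p s {Inr i}) + c * (\<Sum>i\<in>I. expect s (\<lambda>W. (card (free i W) - \<mu>)\<^sup>2))"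
    unfolding F_def expect_add expect_sum p_def by (simp add: sum_distrib_left)
  moreover have "(\<Sum>i\<in>I. p s {Inr i}) \<le> card I * (unmatched s + 2 * w)"
  proof (intro sum_bounded_above)
    fix i assume "i \<in> I"
    then show "p s {Inr i} \<le> unmatched s + 2 * w"
      using err[of "{Inr i}"] q_values(1) by (simp add: \<pi>_def)
  qed
  moreover have "c * (\<Sum>i\<in>I. expect s (\<lambda>W. (card (free i W) - \<mu>)\<^sup>2))
      \<le> c * (card I * (v\<^sup>2 * (3 * 4 ^ k * w) + k\<^sup>2 * v))"
    unfolding \<mu>_def using c variance_free[OF err w] by (intro mult_left_mono sum_bounded_above) auto
  moreover have "c * (card I * (v\<^sup>2 * (3 * 4 ^ k * w) + k\<^sup>2 * v))
      = card I * (4 * 16 ^ k * (3 * 4 ^ k * w + k\<^sup>2 / v))"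
    using v_pos by (simp add: c_def field_simps power2_eq_square)
  ultimately have "card (leftover W) + card (bad s W)
      \<le> card I * (unmatched s + 2 * w) + card I * (4 * 16 ^ k * (3 * 4 ^ k * w + k\<^sup>2 / v))"
    using W(2) by linarith
  then show ?thesis using W(1) by (auto simp: algebra_simps)
qed

text \<open>Bad orbits are placed anywhere; the other orbits that are still unplaced, or are dislodged by
  the bad ones, have many translates disjoint from everything in the matching.\<close>

lemma selection_from_matching:
  assumes W: "matching W"
    and few: "4 ^ k * 2 * k\<^sup>2 * (k + 2) * (card (leftover W) + card (bad s W)) < v"
  shows "\<exists>\<tau>. (\<forall>i\<in>I. \<tau> i < v) \<and> disjoint_family_on (\<lambda>i. block i (\<tau> i)) I"
proof -
  define X where "X = bad s W"
  define n where "n = card (leftover W) + card X"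
  have XI: "X \<subseteq> I" by (auto simp: X_def bad_def)
  have fX: "finite X" using finite_subset[OF XI finite_I] .
  have "1 * (k * (k * n)) \<le> (4 ^ k * 2 * (k + 2)) * (k * (k * n))"
    by (intro mult_le_mono1) (simp add: Suc_le_eq)
  also have "\<dots> < v" using few by (simp add: n_def X_def power2_eq_square mult_ac)
  finally have n: "k * (k * n) < v" by simp
  have "k * (k * card X) \<le> k * (k * n)" by (intro mult_le_mono2) (simp add: n_def)
  with n have "k * (k * card X) < v" by linarith
  then have "\<exists>\<tau>. (\<forall>i\<in>X. \<tau> i \<in> {..<v} \<and> block i (\<tau> i) \<inter> {} = {}) \<and>
      disjoint_family_on (\<lambda>i. block i (\<tau> i)) X"
    using XI by (intro greedy_selection) auto
  then obtain \<tau>X where \<tau>X: "\<And>i. i \<in> X \<Longrightarrow> \<tau>X i < v"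
    and disjX: "disjoint_family_on (\<lambda>i. block i (\<tau>X i)) X" by auto
  define Q where "Q = (\<Union>i\<in>X. block i (\<tau>X i))"
  have "block i (\<tau>X i) \<subseteq> V" if "i \<in> X" for i
    using block[of i "\<tau>X i"] \<tau>X[OF that] XI that by auto
  then have QV: "Q \<subseteq> V" by (auto simp: Q_def)
  have fQ: "finite Q" using finite_subset[OF QV finite_V] .
  have cardQ: "card Q \<le> k * card X"
  proof -
    have "card Q \<le> (\<Sum>i\<in>X. card (block i (\<tau>X i)))"
      unfolding Q_def using fX by (rule card_UN_le)
    also have "\<dots> = (\<Sum>i\<in>X. k)" using \<tau>X XI block by (intro sum.cong) auto
    finally show ?thesis by (simp add: mult.commute)
  qed
  have WE: "W \<subseteq> I \<times> {..<v}" and Wdisj: "disjoint_family_on edge W"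
    using W by (auto simp: matching_def)
  have "\<exists>t. (i, t) \<in> W" if "i \<in> I - leftover W" for i
    using that by (auto simp: leftover_def cover_def edge_def)
  then obtain \<tau>W where \<tau>W: "\<And>i. i \<in> I - leftover W \<Longrightarrow> (i, \<tau>W i) \<in> W" by metis
  define D where "D = {i \<in> I - leftover W. block i (\<tau>W i) \<inter> Q \<noteq> {}}"
  have W_disj: "block i (\<tau>W i) \<inter> block j (\<tau>W j) = {}"
    if "i \<in> I - leftover W" "j \<in> I - leftover W" "i \<noteq> j" for i j
    using disjoint_family_onD[OF Wdisj \<tau>W[OF that(1)] \<tau>W[OF that(2)]] that(3)
    by (auto simp: edge_def)
  \<comment> \<open>Blocks in the matching are disjoint, so each point of \<open>Q\<close> dislodges
    at most one orbit.\<close>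
  have cardD: "card D \<le> card Q"
  proof -
    have "\<exists>x. x \<in> block i (\<tau>W i) \<inter> Q" if "i \<in> D" for i using that by (auto simp: D_def)
    then obtain x where x: "\<And>i. i \<in> D \<Longrightarrow> x i \<in> block i (\<tau>W i) \<inter> Q" by metis
    have "inj_on x D"
    proof (rule inj_onI, rule ccontr)
      fix i j assume ij: "i \<in> D" "j \<in> D" "x i = x j" "i \<noteq> j"
      then have "x i \<in> block i (\<tau>W i) \<inter> block j (\<tau>W j)" using x[of i] x[of j] by auto
      moreover have "block i (\<tau>W i) \<inter> block j (\<tau>W j) = {}"
        using ij by (intro W_disj) (auto simp: D_def)
      ultimately show False by simp
    qed
    then show ?thesis using fQ x by (intro card_inj_on_le[of x]) auto
  qed
  \<comment> \<open>The orbits to be placed anew among their free translates; none of them is bad,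
    so each has many.\<close>
  define G where "G = (leftover W \<union> D) - X"
  have GI: "G \<subseteq> I" by (auto simp: G_def D_def leftover_def)
  have cardG: "card Q + k * card G \<le> k * ((k + 2) * n)"
  proof -
    have kX: "k * card X \<le> k * n" and "card (leftover W) \<le> n"
      by (auto simp: n_def)
    have "card G \<le> card (leftover W \<union> D)"
      unfolding G_def using finite_I by (intro card_mono) (auto simp: D_def leftover_def)
    also have "\<dots> \<le> card (leftover W) + card D" by (rule card_Un_le)
    also have "\<dots> \<le> n + k * n"
      using cardD cardQ kX \<open>card (leftover W) \<le> n\<close> by linarith
    finally have "k * card G \<le> k * (n + k * n)" by (rule mult_le_mono2)
    moreover have "card Q \<le> k * n"
      using cardQ kX by linarith
    ultimately show ?thesis by (simp add: algebra_simps)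
  qed
  have "\<exists>\<tau>. (\<forall>i\<in>G. \<tau> i \<in> free i W \<and> block i (\<tau> i) \<inter> Q = {}) \<and>
      disjoint_family_on (\<lambda>i. block i (\<tau> i)) G"
  proof (rule greedy_selection[OF GI QV])
    fix i assume i: "i \<in> G"
    show "free i W \<subseteq> {..<v}" by (auto simp: free_def)
    \<comment> \<open>Not being bad leaves at least \<open>v / (2 * 4 ^ k)\<close> free translates.
      The denominator is moved to the other side to compare natural numbers.\<close>
    have "v * (1 / 4) ^ k \<le> v * uncovered s ^ k"
      using uncovered_bounds by (intro mult_left_mono power_mono) auto
    moreover have "v * uncovered s ^ k / 2 \<le> card (free i W)"
      using i GI by (auto simp: G_def X_def bad_def)
    ultimately have "v * (1 / 4) ^ k \<le> 2 * real (card (free i W))" by linarith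
    then have "real v \<le> real (4 ^ k * 2 * card (free i W))"
      by (simp add: power_divide field_simps)
    then have "v \<le> 4 ^ k * 2 * card (free i W)" by (simp only: of_nat_le_iff)
    moreover have "4 ^ k * 2 * (k * (k * ((k + 2) * n))) < v"
      using few by (simp add: n_def X_def power2_eq_square algebra_simps)
    moreover have "4 ^ k * 2 * (k * (card Q + k * card G)) \<le> 4 ^ k * 2 * (k * (k * ((k + 2) * n)))"
      using cardG by (intro mult_le_mono2)
    ultimately have "4 ^ k * 2 * (k * (card Q + k * card G)) < 4 ^ k * 2 * card (free i W)"
      by linarith
    then show "k * (card Q + k * card G) < card (free i W)"
      by (simp only: nat_mult_less_cancel_disj)
  qed
  then obtain \<tau>G where \<tau>G: "\<And>i. i \<in> G \<Longrightarrow> \<tau>G i \<in> free i W \<and> block i (\<tau>G i) \<inter> Q = {}"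
    and disjG: "disjoint_family_on (\<lambda>i. block i (\<tau>G i)) G" by blast
  define \<tau> where "\<tau> i = (if i \<in> X then \<tau>X i else if i \<in> G then \<tau>G i else \<tau>W i)" for i
  have kept: "i \<in> I - leftover W \<and> block i (\<tau>W i) \<inter> Q = {}" if "i \<in> I - X - G" for i
    using that by (auto simp: G_def D_def)
  \<comment> \<open>By symmetry it suffices that the class of \<open>i\<close> does not come after
    that of \<open>j\<close> in the order \<open>X\<close>, \<open>G\<close>, kept orbits.\<close>
  have disj: "block i (\<tau> i) \<inter> block j (\<tau> j) = {}"
    if ij: "i \<in> I" "j \<in> I" "i \<noteq> j" "i \<in> X \<or> (j \<notin> X \<and> (i \<in> G \<or> j \<notin> G))" for i j
  proof -
    consider "i \<in> X" "j \<in> X" | "i \<in> X" "j \<in> G" "j \<notin> X" | "i \<in> X" "j \<in> I - X - G"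
      | "i \<notin> X" "i \<in> G" "j \<in> G" "j \<notin> X" | "i \<notin> X" "i \<in> G" "j \<in> I - X - G"
      | "i \<in> I - X - G" "j \<in> I - X - G"
      using ij by blast
    then show ?thesis
    proof cases
      case 1
      then show ?thesis using disjoint_family_onD[OF disjX] ij(3) by (simp add: \<tau>_def)
    next
      case 2
      then show ?thesis using \<tau>G[of j] by (auto simp: \<tau>_def Q_def)
    next
      case 3
      then show ?thesis using kept[of j] by (auto simp: \<tau>_def Q_def)
    next
      case 4
      then show ?thesis using disjoint_family_onD[OF disjG] ij(3) by (simp add: \<tau>_def)
    next
      case 5
      \<comment> \<open>Free translates avoid every point covered by \<open>W\<close>, hence all
        blocks that were kept.\<close>
      then have "(j, \<tau>W j) \<in> W" using kept \<tau>W by blast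
      then have "Inl ` block j (\<tau>W j) \<subseteq> cover W" by (force simp: cover_def edge_def)
      moreover have "Inl ` block i (\<tau>G i) \<inter> cover W = {}" using \<tau>G[of i] 5 by (simp add: free_def)
      ultimately have "block i (\<tau>G i) \<inter> block j (\<tau>W j) = {}" by auto
      then show ?thesis using 5 by (simp add: \<tau>_def)
    next
      case 6
      then show ?thesis using W_disj[of i j] kept ij(3) by (simp add: \<tau>_def)
    qed
  qed
  have "disjoint_family_on (\<lambda>i. block i (\<tau> i)) I"
  proof (unfold disjoint_family_on_def, intro ballI impI)
    fix i j assume "i \<in> I" "j \<in> I" "i \<noteq> j"
    then show "block i (\<tau> i) \<inter> block j (\<tau> j) = {}"
      using disj[of i j] disj[of j i] by (metis Int_commute)
  qed
  moreover have "\<tau> i < v" if i: "i \<in> I" for i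
  proof -
    consider "i \<in> X" | "i \<notin> X" "i \<in> G" | "i \<in> I - X - G" using i by blast
    then show ?thesis
    proof cases
      case 3
      then have "(i, \<tau>W i) \<in> W" using kept \<tau>W by blast
      then show ?thesis using 3 WE by (auto simp: \<tau>_def)
    qed (use \<tau>X[of i] \<tau>G[of i] in \<open>auto simp: \<tau>_def free_def\<close>)
  qed
  ultimately show ?thesis by blast
qed

end

section \<open>Choice of the constants, depending on \<open>k\<close> and \<open>C\<close>
  only\<close>

theorem disjoint_selection_exists:
  fixes k C :: nat
  assumes k_pos: "k > 0"
  shows "\<exists>v0. \<forall>v\<ge>v0. \<forall>(V :: 'a set) (I :: 'i set) block. uniform_orbits V I block v k C \<longrightarrow>
           (\<exists>\<tau>. (\<forall>i\<in>I. \<tau> i < v) \<and> disjoint_family_on (\<lambda>i. block i (\<tau> i)) I)"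
proof -
  define K :: real where "K = 4 ^ k * 2 * k\<^sup>2 * (k + 2)"
  have K: "K \<ge> 1"
  proof -
    have "1 \<le> 4 ^ k * 2 * k\<^sup>2 * (k + 2)" using k_pos by (simp add: Suc_le_eq)
    from of_nat_mono[OF this, where 'a = real] show ?thesis unfolding K_def by simp
  qed
  \<comment> \<open>The tolerated proportion of unmatched and bad orbits:
    \<open>K * (v * \<eta>)\<close> is \<open>v / 2\<close>, as
    \<open>selection_from_matching\<close> demands less than \<open>v\<close>.\<close>
  define \<eta> where "\<eta> = 1 / (2 * K)"
  have \<eta>: "0 < \<eta>" "\<eta> < 1" using K by (auto simp: \<eta>_def)
  \<comment> \<open>After \<open>T * card I\<close> steps, \<open>unmatched_le_exp\<close> gives at
    most \<open>\<eta> / 4\<close>.\<close>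
  define T where "T = ln (4 / \<eta>) * 4 ^ k"
  have T: "T \<ge> 0" using \<eta> by (simp add: T_def)
  \<comment> \<open>The total coefficient of \<open>w\<close> in
    \<open>exists_good_matching\<close>.\<close>
  define D :: real where "D = 2 + 12 * 16 ^ k * 4 ^ k"
  have D: "D > 0" unfolding D_def by (simp add: add_pos_pos)
  define w where "w = \<eta> / (4 * D)"
  have w: "w > 0" using \<eta> D by (simp add: w_def)
  \<comment> \<open>The number of rounds: each will have at least
    \<open>card I / 4 ^ (k + 2)\<close> steps, and \<open>(T + 1) * card I\<close> steps are to be
    covered.\<close>
  define n where "n = nat \<lceil>(T + 1) * 4 ^ (k + 2)\<rceil>"
  obtain \<delta> where \<delta>: "\<delta> > 0" "\<And>x. 0 \<le> x \<Longrightarrow> x \<le> \<delta> \<Longrightarrow> error_bound x n \<le> w"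
    using error_bound_small[OF w, of n] by blast
  \<comment> \<open>The three terms make the variance term at most \<open>\<eta> / 4\<close>, the
    defect at most \<open>\<delta>\<close>, and the number of orbits at least
    \<open>4 ^ (k + 2)\<close>.\<close>
  define M where "M = max (max (16 * 16 ^ k * k\<^sup>2 / \<eta>) ((k\<^sup>2 + C) / \<delta>)) (k\<^sup>2 * 4 ^ (k + 2))"
  define v0 where "v0 = max 1 (nat \<lceil>M\<rceil>)"
  have "\<exists>\<tau>. (\<forall>i\<in>I. \<tau> i < v) \<and> disjoint_family_on (\<lambda>i. block i (\<tau> i)) I"
    if "v \<ge> v0" and unif: "uniform_orbits V I block v k C"
    for v and V :: "'a set" and I :: "'i set" and block
  proof -
    interpret U: uniform_orbits V I block v k C by (fact unif)
    have v: "v \<ge> 1" "v \<ge> M"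
      using \<open>v \<ge> v0\<close> by (auto simp: v0_def nat_le_iff ceiling_le_iff)
    \<comment> \<open>With few orbits, greedy placement alone succeeds. Otherwise
      \<open>card I\<close> is at least a constant times \<open>v\<close>, so
      \<open>h = 1 / card I\<close> is small.\<close>
    show ?thesis
    proof (cases "k * (k * card I) < v")
      case True
      then show ?thesis
        using U.greedy_selection[of I "{}" "\<lambda>_. {..<v}"] by auto
    next
      case False
      then have "I \<noteq> {}" using v by auto
      then interpret nonempty_uniform_orbits V I block v k C by unfold_locales
      define N where "N = real (card I)"
      have N: "N > 0" using card_I_pos by (simp add: N_def)
      have "real v \<le> real (k * (k * card I))" using False by (simp only: of_nat_le_iff not_less)
      then have vN: "v \<le> k\<^sup>2 * N" by (simp add: N_def power2_eq_square mult_ac)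
      have "k\<^sup>2 * 4 ^ (k + 2) \<le> k\<^sup>2 * N" using v(2) vN by (simp add: M_def)
      then have N_large: "4 ^ (k + 2) \<le> N" using k_pos by simp
      have h: "h = 1 / N"
        using v by (simp add: h_def N_def card_cartesian_product)
      have "defect = 1 / N + C / v" by (simp add: defect_def h)
      also have "1 / N \<le> k\<^sup>2 / v" using vN N v by (simp add: field_simps)
      then have "1 / N + C / v \<le> (k\<^sup>2 + C) / v" by (simp add: add_divide_distrib)
      also have "\<dots> \<le> \<delta>" using v \<delta>(1) by (simp add: M_def field_simps)
      finally have defect: "error_bound defect n \<le> w"
        using \<delta>(2)[of defect] defect_pos by simp
      \<comment> \<open>The longest round that \<open>error_le_error_bound\<close> admits for edges
        of size \<open>Suc k\<close>.\<close>
      define L where "L = nat \<lfloor>2 * N / 4 ^ (k + 2)\<rfloor>"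
      define s where "s = nat \<lceil>T * N\<rceil>"
      have L: "real L \<le> 2 * N / 4 ^ (k + 2)" "N / 4 ^ (k + 2) \<le> L"
      proof -
        show "real L \<le> 2 * N / 4 ^ (k + 2)"
          unfolding L_def using N by (intro of_nat_floor) simp
        \<comment> \<open>Rounding down then loses at most half of
          \<open>2 * N / 4 ^ (k + 2)\<close>.\<close>
        have "1 \<le> N / 4 ^ (k + 2)" using N_large by simp
        moreover have "2 * N / 4 ^ (k + 2) - 1 \<le> L"
          unfolding L_def by linarith
        ultimately show "N / 4 ^ (k + 2) \<le> L" by (simp add: field_simps)
      qed
      have Lh: "real L * h * 4 ^ Suc (Suc k) \<le> 2"
        using L(1) N by (simp add: h field_simps)
      have s_le: "s \<le> n * L"
      proof -
        have "0 \<le> T * N" using T N by simp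
        then have "real s \<le> T * N + 1" unfolding s_def by linarith
        also have "\<dots> \<le> (T + 1) * N"
          using N_large one_le_power[of "4 :: real" "k + 2"] by (simp add: algebra_simps)
        also have "\<dots> = ((T + 1) * 4 ^ (k + 2)) * (N / 4 ^ (k + 2))" by simp
        also have "\<dots> \<le> real n * real L"
        proof (rule mult_mono[OF _ L(2)])
          show "(T + 1) * 4 ^ (k + 2) \<le> real n"
            unfolding n_def by (rule real_nat_ceiling_ge)
        qed (use N in auto)
        finally have "real s \<le> real (n * L)" by simp
        then show ?thesis by (simp only: of_nat_le_iff)
      qed
      have err: "\<bar>p s S - \<pi> s S\<bar> \<le> w * 2 ^ card S" if "finite S" for S
        using error_le_error_bound[OF Lh s_le that] mult_right_mono[OF defect, of "2 ^ card S"]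
        by (rule order_trans) simp
      obtain W where W: "matching W" and few: "card (leftover W) + card (bad s W)
          \<le> card I * (unmatched s + 2 * w + 4 * 16 ^ k * (3 * 4 ^ k * w + k\<^sup>2 / v))"
        using exists_good_matching[OF err] w by auto
      have "unmatched s \<le> \<eta> / 4"
      proof -
        have "ln (4 / \<eta>) \<le> (1 / 4) ^ k * s / card I"
        proof -
          have "T * N \<le> s" unfolding s_def by (rule real_nat_ceiling_ge)
          then have "(1 / 4) ^ k * (T * N) / N \<le> (1 / 4) ^ k * s / N"
            using N by (intro divide_right_mono mult_left_mono) auto
          then show ?thesis using N by (simp add: T_def power_divide N_def)
        qed
        then have "exp (- ((1 / 4) ^ k * s / card I)) \<le> exp (- ln (4 / \<eta>))" by simp
        also have "\<dots> = \<eta> / 4" using \<eta> by (simp add: exp_minus)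
        finally show ?thesis using unmatched_le_exp[of s] by linarith
      qed
      moreover have "2 * w + 4 * 16 ^ k * (3 * 4 ^ k * w) = \<eta> / 4"
      proof -
        have "2 * w + 4 * 16 ^ k * (3 * 4 ^ k * w) = w * D"
          by (simp add: D_def algebra_simps)
        then show ?thesis using D by (simp add: w_def)
      qed
      moreover have "4 * 16 ^ k * (k\<^sup>2 / v) \<le> \<eta> / 4"
      proof -
        have "16 * 16 ^ k * k\<^sup>2 / \<eta> \<le> v" using v(2) by (simp add: M_def)
        then show ?thesis using \<eta> v by (simp add: field_simps)
      qed
      ultimately have "unmatched s + 2 * w + 4 * 16 ^ k * (3 * 4 ^ k * w + k\<^sup>2 / v) \<le> \<eta>"
        using \<eta> unfolding distrib_left by linarith
      then have "card I * (unmatched s + 2 * w + 4 * 16 ^ k * (3 * 4 ^ k * w + k\<^sup>2 / v)) \<le> v * \<eta>"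
        using card_I_le \<eta> by (meson mult_left_mono mult_right_mono of_nat_0_le_iff of_nat_mono order_trans less_imp_le)
      with few have "real (card (leftover W) + card (bad s W)) \<le> v * \<eta>" by simp
      then have "K * (card (leftover W) + card (bad s W)) \<le> K * (v * \<eta>)"
        using K by (intro mult_left_mono) auto
      also have "\<dots> < v" using K v by (simp add: \<eta>_def)
      finally have "real (4 ^ k * 2 * k\<^sup>2 * (k + 2) * (card (leftover W) + card (bad s W))) < real v"
        by (simp add: K_def)
      then have "4 ^ k * 2 * k\<^sup>2 * (k + 2) * (card (leftover W) + card (bad s W)) < v"
        by (simp only: of_nat_less_iff)
      from selection_from_matching[OF W this] show ?thesis .
    qed
  qed
  then show ?thesis by blast
qed

section \<open>Cyclic designs\<close>

locale cyclic_set =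
  fixes V :: "'a set" and \<sigma> :: "'a \<Rightarrow> 'a" and v :: nat
  assumes finite_V: "finite V" and card_V: "card V = v" and v_pos: "v > 0"
    and permutes: "\<sigma> permutes V" and cyclic: "cyclic_on \<sigma> V"
begin

lemma inj_funpow: "inj (\<sigma> ^^ t)"
  by (rule inj_fn[OF permutes_inj[OF permutes]])

text \<open>The orbit of \<open>x\<close> is all of \<open>V\<close>, so the first return time of
  \<open>x\<close> is \<open>card V\<close>.\<close>

lemma funpow_period:
  assumes "x \<in> V"
  shows "(\<sigma> ^^ v) x = x" and bij_betw_funpow: "bij_betw (\<lambda>t. (\<sigma> ^^ t) x) {..<v} V"
proof -
  have orb: "orbit \<sigma> x = V" by (rule orbit_cyclic_eq3[OF cyclic assms])
  with assms have x: "x \<in> orbit \<sigma> x" by simp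
  let ?d = "funpow_dist1 \<sigma> x x"
  have V: "V = (\<lambda>t. (\<sigma> ^^ t) x) ` {0..<?d}"
    using orbit_conv_funpow_dist1[OF x] orb by simp
  have inj: "inj_on (\<lambda>t. (\<sigma> ^^ t) x) {0..<?d}" by (rule inj_on_funpow_dist1[OF x])
  have d: "?d = v" using card_image[OF inj] V card_V by (metis card_atLeastLessThan diff_zero)
  show "(\<sigma> ^^ v) x = x" using funpow_dist1_prop[OF x] d by simp
  show "bij_betw (\<lambda>t. (\<sigma> ^^ t) x) {..<v} V"
    using inj V unfolding d bij_betw_def by (simp add: lessThan_atLeast0)
qed

lemma dvd_if_fixed:
  assumes "x \<in> V" and "(\<sigma> ^^ m) x = x"
  shows "v dvd m"
proof -
  have "(\<sigma> ^^ (m mod v)) x = (\<sigma> ^^ 0) x"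
    using funpow_mod_eq[OF funpow_period(1)[OF assms(1)]] assms(2) by simp
  then have "m mod v = 0"
    using inj_onD[OF bij_betw_imp_inj_on[OF bij_betw_funpow[OF assms(1)]], of "m mod v" 0] v_pos by simp
  then show ?thesis by (simp add: mod_eq_0_iff_dvd)
qed

lemma image_funpow: "(image \<sigma> ^^ t) b = (\<sigma> ^^ t) ` b"
  by (induction t) (auto simp: image_image)

lemma block_orbit_eq:
  assumes "b \<subseteq> V"
  shows "block_orbit \<sigma> b = {(\<sigma> ^^ t) ` b | t. t < v}"
proof -
  have "(\<sigma> ^^ v) ` b = (\<lambda>x. x) ` b"
    using assms funpow_period(1) by (intro image_cong) auto
  then have "(image \<sigma> ^^ v) b = b" by (simp add: image_funpow)
  then show ?thesis
    using orbit_altdef_bounded[of v "image \<sigma>" b] v_pos by (simp add: image_funpow)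
qed

lemma self_in_block_orbit: "b \<subseteq> V \<Longrightarrow> b \<in> block_orbit \<sigma> b"
  using v_pos by (auto simp: block_orbit_eq intro!: exI[of _ 0])

lemma block_orbit_translate:
  assumes "b \<subseteq> V" and "b' \<in> block_orbit \<sigma> b"
  shows "block_orbit \<sigma> b' = block_orbit \<sigma> b"
  using assms self_in_block_orbit orbit_cyclic_eq3[of "image \<sigma>" "block_orbit \<sigma> b" b']
  unfolding cyclic_on_def by blast

text \<open>Each point of \<open>b\<close> is carried to \<open>x\<close> by exactly one exponent
  below \<open>v\<close>, and distinct points need distinct exponents.\<close>

lemma card_translates_through:
  assumes "b \<subseteq> V" and "x \<in> V"
  shows "card {t. t < v \<and> x \<in> (\<sigma> ^^ t) ` b} = card b"
proof -
  have "\<exists>t<v. (\<sigma> ^^ t) y = x" if "y \<in> b" for y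
    using bij_betw_imp_surj_on[OF bij_betw_funpow, of y] that assms by force
  then obtain g where g: "\<And>y. y \<in> b \<Longrightarrow> g y < v \<and> (\<sigma> ^^ g y) y = x" by metis
  have "inj_on g b"
  proof (rule inj_onI)
    fix y y' assume y: "y \<in> b" "y' \<in> b" "g y = g y'"
    then have "(\<sigma> ^^ g y) y = (\<sigma> ^^ g y) y'" using g by metis
    then show "y = y'" using inj_funpow by (simp add: inj_eq)
  qed
  moreover have "g ` b = {t. t < v \<and> x \<in> (\<sigma> ^^ t) ` b}"
  proof
    show "g ` b \<subseteq> {t. t < v \<and> x \<in> (\<sigma> ^^ t) ` b}" using g by force
    show "{t. t < v \<and> x \<in> (\<sigma> ^^ t) ` b} \<subseteq> g ` b"
    proof
      fix t assume "t \<in> {t. t < v \<and> x \<in> (\<sigma> ^^ t) ` b}"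
      then obtain y where y: "y \<in> b" "t < v" "(\<sigma> ^^ t) y = x" by auto
      then have "t = g y"
        using g[of y] inj_onD[OF bij_betw_imp_inj_on[OF bij_betw_funpow], of y t "g y"] assms by auto
      then show "t \<in> g ` b" using y by simp
    qed
  qed
  ultimately show ?thesis using card_image by metis
qed

end

lemma card_distinct_pairs:
  assumes "finite A"
  shows "card {z \<in> A \<times> A. fst z \<noteq> snd z} = card A * (card A - 1)"
proof -
  have "{z \<in> A \<times> A. fst z \<noteq> snd z} = (SIGMA x:A. A - {x})" by auto
  then show ?thesis using assms by (simp add: card_SigmaI card_Diff_singleton)
qed

text \<open>For fixed \<open>j\<close>, the shift \<open>d\<close> is recovered from the quotient
  \<open>j * d div v\<close>, which is less than \<open>j\<close>. These \<open>d\<close> are the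
  possible shifts fixing a block with \<open>k\<close> points.\<close>

lemma card_small_multiples:
  fixes v k :: nat
  shows "card {d. 0 < d \<and> d < v \<and> (\<exists>j\<in>{1..k}. v dvd j * d)} \<le> k\<^sup>2"
proof -
  have "{d. 0 < d \<and> d < v \<and> (\<exists>j\<in>{1..k}. v dvd j * d)} = (\<Union>j\<in>{1..k}. {d. 0 < d \<and> d < v \<and> v dvd j * d})"
    by auto
  also have "card \<dots> \<le> (\<Sum>j\<in>{1..k}. card {d. 0 < d \<and> d < v \<and> v dvd j * d})"
    by (rule card_UN_le) simp
  also have "\<dots> \<le> of_nat (card {1..k}) * k"
  proof (rule sum_bounded_above)
    fix j assume j: "j \<in> {1..k}"
    have "card {d. 0 < d \<and> d < v \<and> v dvd j * d} \<le> card {..<j}"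
    proof (rule card_inj_on_le[where f = "\<lambda>d. j * d div v"])
      show "inj_on (\<lambda>d. j * d div v) {d. 0 < d \<and> d < v \<and> v dvd j * d}"
      proof (rule inj_onI)
        fix d d' assume "d \<in> {d. 0 < d \<and> d < v \<and> v dvd j * d}" "d' \<in> {d. 0 < d \<and> d < v \<and> v dvd j * d}"
          "j * d div v = j * d' div v"
        then have "j * d = j * d'" by (metis (mono_tags, lifting) dvd_div_mult_self mem_Collect_eq)
        then show "d = d'" using j by simp
      qed
      show "(\<lambda>d. j * d div v) ` {d. 0 < d \<and> d < v \<and> v dvd j * d} \<subseteq> {..<j}"
        using j by (auto simp: div_less_iff_less_mult)
    qed simp
    then show "card {d. 0 < d \<and> d < v \<and> v dvd j * d} \<le> k" using j by simp
  qed
  finally show ?thesis by (simp add: power2_eq_square)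
qed

section \<open>The orbits of a cyclic design as a uniform family\<close>

locale cyclic_design_orbits = cyclic_set +
  fixes \<B> :: "'a set multiset" and k l :: nat
  assumes design: "design v k l V \<B>" and aut: "design_automorphism V \<B> \<sigma>"
    and k_pos: "k > 0"
begin

abbreviation I :: "('a set set \<times> nat) set" where "I \<equiv> block_orbits \<sigma> \<B>"

text \<open>The base block depends on the set of translates only, so all copies of a repeated orbit
  share it.\<close>

definition rep :: "'a set set \<Rightarrow> 'a set" where
  "rep Orb = (SOME b. b \<in># \<B> \<and> block_orbit \<sigma> b = Orb)"

definition block :: "'a set set \<times> nat \<Rightarrow> nat \<Rightarrow> 'a set" where
  "block z t = (\<sigma> ^^ t) ` rep (fst z)"

lemma in_\<B>: "b \<in># \<B> \<Longrightarrow> b \<subseteq> V \<and> card b = k"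
  using design by (simp add: design_def)

lemma rep:
  assumes "z \<in> I"
  shows "rep (fst z) \<in># \<B>" "block_orbit \<sigma> (rep (fst z)) = fst z" "snd z < count \<B> (rep (fst z))"
proof -
  from assms obtain b where b: "b \<in># \<B>" "fst z = block_orbit \<sigma> b" "snd z < count \<B> b"
    by (auto simp: block_orbits_def)
  have *: "rep (fst z) \<in># \<B> \<and> block_orbit \<sigma> (rep (fst z)) = fst z"
    unfolding rep_def by (rule someI[of _ b]) (use b in auto)
  then have "rep (fst z) \<in> block_orbit \<sigma> b"
    using self_in_block_orbit[of "rep (fst z)"] in_\<B> b by metis
  then have "count \<B> (rep (fst z)) = count \<B> b" by (rule count_block_orbit[OF aut])
  with * b show "rep (fst z) \<in># \<B>" "block_orbit \<sigma> (rep (fst z)) = fst z" "snd z < count \<B> (rep (fst z))"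
    by auto
qed

lemma rep_in_V: "z \<in> I \<Longrightarrow> rep (fst z) \<subseteq> V"
  using rep(1) in_\<B> by blast

lemma block_in_orbit: "z \<in> I \<Longrightarrow> t < v \<Longrightarrow> block z t \<in> fst z"
  using block_orbit_eq[OF rep_in_V, of z] rep(2)[of z] unfolding block_def by blast

lemma block_in_\<B>:
  assumes "z \<in> I" "t < v"
  shows "block z t \<in># \<B>" "snd z < count \<B> (block z t)" "block_orbit \<sigma> (block z t) = fst z"
proof -
  have mem: "block z t \<in> block_orbit \<sigma> (rep (fst z))"
    using block_in_orbit[OF assms] rep(2)[OF assms(1)] by simp
  show "snd z < count \<B> (block z t)"
    using count_block_orbit[OF aut mem] rep(3)[OF assms(1)] by simp
  then show "block z t \<in># \<B>" by (metis count_greater_zero_iff not_less_zero gr0I)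
  show "block_orbit \<sigma> (block z t) = fst z"
    using block_orbit_translate[OF rep_in_V[OF assms(1)] mem] rep(2)[OF assms(1)] by simp
qed

lemma finite_I: "finite I"
proof (rule finite_subset)
  show "I \<subseteq> block_orbit \<sigma> ` set_mset \<B> \<times> {..<size \<B>}"
    using count_le_size[of \<B>] by (fastforce simp: block_orbits_def intro: less_le_trans)
qed simp

lemma regular: "z \<in> I \<Longrightarrow> x \<in> V \<Longrightarrow> card {t. t < v \<and> x \<in> block z t} = k"
  using card_translates_through[OF rep_in_V] in_\<B>[OF rep(1)] by (simp add: block_def)

text \<open>Turns the multiset of blocks through two points into a set of pairs of a block and a
  copy number, which suits counting by injections and unions.\<close>

lemma card_blocks_through:
  assumes "x \<in> V" "y \<in> V" "x \<noteq> y"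
  shows "card (SIGMA b:{b \<in> set_mset \<B>. x \<in> b \<and> y \<in> b}. {..<count \<B> b}) = l"
proof -
  have "size {#b \<in># \<B>. x \<in> b \<and> y \<in> b#} = l" using design assms by (simp add: design_def)
  then show ?thesis
    by (simp add: card_SigmaI size_multiset_overloaded_eq)
qed

text \<open>\<open>(z, t)\<close> determines one of \<open>l\<close> block copies through
  \<open>x\<close> and \<open>y\<close>. The copy determines \<open>z\<close>, but in a short orbit
  not \<open>t\<close>; as \<open>x\<close> must lie in \<open>block z t\<close>, there are
  \<open>k\<close> candidates for \<open>t\<close>.\<close>

lemma pairs:
  assumes "x \<in> V" "y \<in> V" "x \<noteq> y"
  shows "card {(z, t). z \<in> I \<and> t < v \<and> x \<in> block z t \<and> y \<in> block z t} \<le> k * l"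
proof -
  let ?R = "SIGMA b:{b \<in> set_mset \<B>. x \<in> b \<and> y \<in> b}. {..<count \<B> b}"
  let ?F = "\<lambda>r. {(block_orbit \<sigma> (fst r), snd r)} \<times> {t. t < v \<and> x \<in> block (block_orbit \<sigma> (fst r), snd r) t}"
  have fin: "finite ?R" by (intro finite_SigmaI) auto
  have "{(z, t). z \<in> I \<and> t < v \<and> x \<in> block z t \<and> y \<in> block z t} \<subseteq> (\<Union>r\<in>?R. ?F r)"
  proof clarify
    fix O' j t assume zt: "(O', j) \<in> I" "t < v" "x \<in> block (O', j) t" "y \<in> block (O', j) t"
    have "(block (O', j) t, j) \<in> ?R" using block_in_\<B>[OF zt(1,2)] zt by simp
    moreover have "((O', j), t) \<in> ?F (block (O', j) t, j)" using block_in_\<B>(3)[OF zt(1,2)] zt by simp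
    ultimately show "((O', j), t) \<in> (\<Union>r\<in>?R. ?F r)" by blast
  qed
  then have "card {(z, t). z \<in> I \<and> t < v \<and> x \<in> block z t \<and> y \<in> block z t} \<le> card (\<Union>r\<in>?R. ?F r)"
    using fin by (intro card_mono) auto
  also have "\<dots> \<le> (\<Sum>r\<in>?R. card (?F r))" using fin by (rule card_UN_le)
  also have "\<dots> = (\<Sum>r\<in>?R. k)"
  proof (rule sum.cong)
    fix r assume "r \<in> ?R"
    then have "(block_orbit \<sigma> (fst r), snd r) \<in> I" by (auto simp: block_orbits_def)
    then show "card (?F r) = k" using regular assms by (simp add: card_cartesian_product)
  qed simp
  also have "\<dots> = k * l" using card_blocks_through[OF assms] by (simp add: mult.commute)
  finally show ?thesis .
qed

section \<open>Counting full and short orbits\<close>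

definition full :: "('a set set \<times> nat) set" where
  "full = {z \<in> I. inj_on (block z) {..<v}}"

text \<open>In a full orbit the block also determines \<open>t\<close>, so the factor
  \<open>k\<close> of \<open>pairs\<close> disappears.\<close>

lemma pairs_full:
  assumes "x \<in> V" "y \<in> V" "x \<noteq> y"
  shows "card {e \<in> full \<times> {..<v}. x \<in> block (fst e) (snd e) \<and> y \<in> block (fst e) (snd e)} \<le> l"
proof -
  let ?P = "{e \<in> full \<times> {..<v}. x \<in> block (fst e) (snd e) \<and> y \<in> block (fst e) (snd e)}"
  let ?R = "SIGMA b:{b \<in> set_mset \<B>. x \<in> b \<and> y \<in> b}. {..<count \<B> b}"
  have "card ?P \<le> card ?R"
  proof (rule card_inj_on_le[where f = "\<lambda>e. (block (fst e) (snd e), snd (fst e))"])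
    show "inj_on (\<lambda>e. (block (fst e) (snd e), snd (fst e))) ?P"
    proof (rule inj_onI)
      fix e e' assume e: "e \<in> ?P" "e' \<in> ?P"
        and eq: "(block (fst e) (snd e), snd (fst e)) = (block (fst e') (snd e'), snd (fst e'))"
      have "fst e \<in> I" "fst e' \<in> I" using e by (auto simp: full_def)
      then have "fst (fst e) = fst (fst e')"
        using block_in_\<B>(3)[of "fst e" "snd e"] block_in_\<B>(3)[of "fst e'" "snd e'"] e eq by auto
      then have z: "fst e = fst e'" using eq by (simp add: prod_eq_iff)
      have "inj_on (block (fst e)) {..<v}" using e by (auto simp: full_def)
      from inj_onD[OF this, of "snd e" "snd e'"] have "snd e = snd e'"
        using e eq z by auto
      with z show "e = e'" by (simp add: prod_eq_iff)
    qed
    show "(\<lambda>e. (block (fst e) (snd e), snd (fst e))) ` ?P \<subseteq> ?R"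
      using block_in_\<B> by (auto simp: full_def)
    show "finite ?R" by (intro finite_SigmaI) auto
  qed
  with card_blocks_through[OF assms] show ?thesis by simp
qed

text \<open>Double counting of translates in full orbits together with ordered pairs of distinct
  points in them; a factor \<open>v\<close> cancels.\<close>

lemma card_full: "card full * (k * (k - 1)) \<le> (v - 1) * l"
proof -
  have ff: "finite full" using finite_I by (simp add: full_def)
  define P where "P = {z \<in> V \<times> V. fst z \<noteq> snd z}"
  define R where "R e xy \<longleftrightarrow> fst xy \<in> block (fst e) (snd e) \<and> snd xy \<in> block (fst e) (snd e)" for e xy
  have fP: "finite P" using finite_V by (simp add: P_def)
  have "(\<Sum>e\<in>full \<times> {..<v}. card {xy \<in> P. R e xy}) = (\<Sum>xy\<in>P. card {e \<in> full \<times> {..<v}. R e xy})"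
    using ff fP by (intro sum_multicount_gen) auto
  also have "\<dots> \<le> of_nat (card P) * l"
    using pairs_full by (intro sum_bounded_above) (auto simp: P_def R_def)
  also have "card P = v * (v - 1)"
    unfolding P_def using card_distinct_pairs[OF finite_V] card_V by simp
  also have "(\<Sum>e\<in>full \<times> {..<v}. card {xy \<in> P. R e xy}) = (\<Sum>e\<in>full \<times> {..<v}. k * (k - 1))"
  proof (rule sum.cong)
    fix e assume "e \<in> full \<times> {..<v}"
    then have "fst e \<in> I" "snd e < v" by (auto simp: full_def)
    then have b: "block (fst e) (snd e) \<subseteq> V" "card (block (fst e) (snd e)) = k"
      using in_\<B>[OF block_in_\<B>(1)] by auto
    then have "{xy \<in> P. R e xy} =
        {z \<in> block (fst e) (snd e) \<times> block (fst e) (snd e). fst z \<noteq> snd z}"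
      by (auto simp: P_def R_def)
    then show "card {xy \<in> P. R e xy} = k * (k - 1)"
      using card_distinct_pairs[OF finite_subset[OF b(1) finite_V]] b(2) by simp
  qed simp
  finally have "v * (card full * (k * (k - 1))) \<le> v * ((v - 1) * l)"
    by (simp add: card_cartesian_product mult_ac)
  then show ?thesis using v_pos by simp
qed

text \<open>Two equal translates give a shift by \<open>d\<close> that fixes the block. The
  \<open>k + 1\<close> iterates of \<open>x\<close> under it, starting with \<open>x\<close>, stay
  in a block of \<open>k\<close> points, so two of them agree and \<open>v\<close> divides a small
  multiple of \<open>d\<close>.\<close>

lemma short_orbit_difference:
  assumes "z \<in> I - full" and "x \<in> V"
  shows "\<exists>d t. 0 < d \<and> d < v \<and> (\<exists>j\<in>{1..k}. v dvd j * d) \<and> t < v \<and> x \<in> block z t \<and> (\<sigma> ^^ d) x \<in> block z t"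
proof -
  have zI: "z \<in> I" using assms by simp
  from assms(1) obtain t1 t2 where t12: "t1 < v" "t2 < v" "block z t1 = block z t2" "t1 < t2"
    by (auto simp: full_def inj_on_def) (metis nat_neq_iff)
  define d where "d = t2 - t1"
  have d: "0 < d" "d < v" using t12 by (auto simp: d_def)
  have "t2 = t1 + d" using t12 by (simp add: d_def)
  then have "(\<sigma> ^^ t1) ` rep (fst z) = (\<sigma> ^^ t1) ` ((\<sigma> ^^ d) ` rep (fst z))"
    using t12(3) by (simp add: block_def funpow_add image_comp)
  then have fixed: "(\<sigma> ^^ d) ` rep (fst z) = rep (fst z)"
    using inj_funpow by (metis inj_image_eq_iff)
  have "{t. t < v \<and> x \<in> block z t} \<noteq> {}" using regular[OF zI assms(2)] k_pos by (metis card.empty less_irrefl)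
  then obtain t where t: "t < v" "x \<in> block z t" by auto
  have stable: "(\<sigma> ^^ d) y \<in> block z t" if "y \<in> block z t" for y
  proof -
    from that obtain u where u: "u \<in> rep (fst z)" "y = (\<sigma> ^^ t) u" by (auto simp: block_def)
    have "(\<sigma> ^^ d) y = (\<sigma> ^^ t) ((\<sigma> ^^ d) u)"
      unfolding u by (metis add.commute comp_apply funpow_add)
    moreover have "(\<sigma> ^^ d) u \<in> rep (fst z)" using fixed u by blast
    ultimately show ?thesis by (simp add: block_def)
  qed
  have mem: "(\<sigma> ^^ (j * d)) x \<in> block z t" for j
    by (induction j) (use t stable in \<open>auto simp: funpow_add\<close>)
  have "card (block z t) = k" "finite (block z t)"
    using in_\<B>[OF block_in_\<B>(1)[OF zI t(1)]] finite_subset finite_V by auto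
  then have "card ((\<lambda>j. (\<sigma> ^^ (j * d)) x) ` {..k}) \<le> k"
    using mem card_mono[of "block z t" "(\<lambda>j. (\<sigma> ^^ (j * d)) x) ` {..k}"] by auto
  then have "\<not> inj_on (\<lambda>j. (\<sigma> ^^ (j * d)) x) {..k}"
    using card_image[of "\<lambda>j. (\<sigma> ^^ (j * d)) x" "{..k}"] by auto
  then obtain j1 j2 where j: "j1 < j2" "j2 \<le> k" "(\<sigma> ^^ (j1 * d)) x = (\<sigma> ^^ (j2 * d)) x"
    by (auto simp: inj_on_def) (metis nat_neq_iff)
  have "j2 * d = j1 * d + (j2 - j1) * d" using j(1) by (simp flip: distrib_right)
  then have "(\<sigma> ^^ (j1 * d)) x = (\<sigma> ^^ (j1 * d)) ((\<sigma> ^^ ((j2 - j1) * d)) x)"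
    using j(3) by (simp add: funpow_add)
  then have "(\<sigma> ^^ ((j2 - j1) * d)) x = x" using inj_funpow by (metis injD)
  then have "v dvd (j2 - j1) * d" by (rule dvd_if_fixed[OF assms(2)])
  moreover have "j2 - j1 \<in> {1..k}" using j by auto
  ultimately show ?thesis using d t stable[OF t(2)] by blast
qed

text \<open>Fix one point \<open>x\<close>. Every short orbit has a block through \<open>x\<close>
  and its shift by some \<open>d\<close> in \<open>T\<close>; there are few such \<open>d\<close>,
  and \<open>pairs\<close> bounds the orbits for each.\<close>

lemma card_short: "card (I - full) \<le> k\<^sup>2 * (k * l)"
proof -
  obtain x where x: "x \<in> V" using card_V v_pos by (metis card.empty ex_in_conv less_irrefl)
  define T where "T = {d. 0 < d \<and> d < v \<and> (\<exists>j\<in>{1..k}. v dvd j * d)}"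
  define F where "F d = {(z, t). z \<in> I \<and> t < v \<and> x \<in> block z t \<and> (\<sigma> ^^ d) x \<in> block z t}" for d
  have fT: "finite T" by (simp add: T_def)
  have fF: "finite (F d)" for d
    by (rule finite_subset[of _ "I \<times> {..<v}"]) (use finite_I in \<open>auto simp: F_def\<close>)
  have "I - full \<subseteq> fst ` (\<Union>d\<in>T. F d)"
  proof
    fix z assume z: "z \<in> I - full"
    from short_orbit_difference[OF this x] obtain d t where "d \<in> T" "(z, t) \<in> F d"
      using z by (auto simp: T_def F_def)
    then show "z \<in> fst ` (\<Union>d\<in>T. F d)" by force
  qed
  then have "card (I - full) \<le> card (fst ` (\<Union>d\<in>T. F d))"
    using fT fF by (intro card_mono) auto
  also have "\<dots> \<le> card (\<Union>d\<in>T. F d)" using fT fF by (intro card_image_le) auto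
  also have "\<dots> \<le> (\<Sum>d\<in>T. card (F d))" using fT by (rule card_UN_le)
  also have "\<dots> \<le> of_nat (card T) * (k * l)"
  proof (rule sum_bounded_above)
    fix d assume d: "d \<in> T"
    have "(\<sigma> ^^ d) x \<noteq> x" using dvd_if_fixed[OF x, of d] d by (auto simp: T_def nat_dvd_not_less)
    moreover have "(\<sigma> ^^ d) x \<in> V" by (rule cyclic_on_funpow_in[OF cyclic x])
    ultimately show "card (F d) \<le> k * l" unfolding F_def using x by (intro pairs) auto
  qed
  also have "\<dots> \<le> k\<^sup>2 * (k * l)"
    using card_small_multiples[of v k] by (auto simp: T_def intro: mult_le_mono1)
  finally show ?thesis .
qed

text \<open>Here \<open>k \<ge> 2 * l + 1\<close> enters: with \<open>card_full\<close> it yields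
  \<open>2 * k * card full < v\<close>, so full orbits account for at most \<open>2 * v\<close> on
  the left. For large \<open>v\<close> the short ones account for at most \<open>v\<close>.\<close>

lemma card_I:
  assumes "k \<ge> 2 * l + 1" and "l > 0" and "v \<ge> 4 * k * (k\<^sup>2 * (k * l))"
  shows "4 * k * card I \<le> 3 * v"
proof -
  have k1: "k - 1 > 0" using assms by simp
  have "(card full * (2 * k)) * (k - 1) = 2 * (card full * (k * (k - 1)))" by simp
  also have "\<dots> \<le> 2 * ((v - 1) * l)" using card_full by simp
  also have "\<dots> = (v - 1) * (2 * l)" by simp
  also have "\<dots> \<le> (v - 1) * (k - 1)" using assms(1) by (intro mult_le_mono2) simp
  finally have "card full * (2 * k) \<le> v - 1" using k1 by simp
  moreover have "card I = card full + card (I - full)"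
  proof -
    have "full \<subseteq> I" by (auto simp: full_def)
    then show ?thesis
      using finite_I finite_subset[of full I] card_mono[of I full] by (simp add: card_Diff_subset)
  qed
  moreover have "4 * k * card (I - full) \<le> v"
    using mult_le_mono2[OF card_short, of "4 * k"] assms(3) by linarith
  ultimately show ?thesis by (simp add: algebra_simps)
qed

end

theorem theorem3:
  fixes k l :: nat
  assumes "k > 0" and "l > 0" and "k \<ge> 2 * l + 1"
  shows "\<exists>v0::nat. \<forall>v \<ge> v0. \<forall>(V :: nat set) \<B> \<sigma>. cyclic_design v k l V \<B> \<sigma> \<longrightarrow>
           (\<exists>c. (\<forall>(Orb, i) \<in> block_orbits \<sigma> \<B>. c (Orb, i) \<in> Orb) \<and>
                disjoint_family_on c (block_orbits \<sigma> \<B>))"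
proof -
  obtain v1 where v1: "\<And>v (V :: nat set) (I :: (nat set set \<times> nat) set) block. v \<ge> v1 \<Longrightarrow>
      uniform_orbits V I block v k (k * l) \<Longrightarrow>
      \<exists>\<tau>. (\<forall>i\<in>I. \<tau> i < v) \<and> disjoint_family_on (\<lambda>i. block i (\<tau> i)) I"
    using disjoint_selection_exists[OF assms(1), of "k * l"] by metis
  define v0 where "v0 = max v1 (max 1 (4 * k * (k\<^sup>2 * (k * l))))"
  have "\<exists>c. (\<forall>(Orb, i) \<in> block_orbits \<sigma> \<B>. c (Orb, i) \<in> Orb) \<and>
            disjoint_family_on c (block_orbits \<sigma> \<B>)"
    if "v \<ge> v0" and cyc: "cyclic_design v k l V \<B> \<sigma>" for v and V :: "nat set" and \<B> \<sigma>
  proof -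
    have v: "v \<ge> v1" "v > 0" "v \<ge> 4 * k * (k\<^sup>2 * (k * l))" using that(1) by (auto simp: v0_def)
    interpret cyclic_design_orbits V \<sigma> v \<B> k l
      using cyc v(2) assms(1)
      by unfold_locales (auto simp: cyclic_design_def design_def design_automorphism_def)
    \<comment> \<open>The codegree bound is \<open>k * l\<close>; it is at least \<open>k\<close>
      because \<open>l > 0\<close>.\<close>
    have "uniform_orbits V (block_orbits \<sigma> \<B>) block v k (k * l)"
    proof
      show "4 * k * card (block_orbits \<sigma> \<B>) \<le> 3 * v"
        using card_I assms v(3) by simp
    qed (use finite_V card_V finite_I assms regular pairs in_\<B>[OF block_in_\<B>(1)] in auto)
    from v1[OF v(1) this] obtain \<tau> where \<tau>: "\<And>z. z \<in> block_orbits \<sigma> \<B> \<Longrightarrow> \<tau> z < v"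
      and disj: "disjoint_family_on (\<lambda>z. block z (\<tau> z)) (block_orbits \<sigma> \<B>)" by blast
    have "\<forall>(Orb, i) \<in> block_orbits \<sigma> \<B>. block (Orb, i) (\<tau> (Orb, i)) \<in> Orb"
      using block_in_orbit \<tau> by fastforce
    with disj show ?thesis by (intro exI[of _ "\<lambda>z. block z (\<tau> z)"]) auto
  qed
  then show ?thesis by blast
qed

end
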